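(* Let $(E^{\bar\odot},\omega^\odot)$ be a spatial product system of Hilbert $\mathcal B$-$\mathcal B$-modules. Then the set $$\mathcal U_\omega(E^{\bar\odot}):=\{\xi^\odot\in\mathcal U(E^{\bar\odot}):\ \mathfrak U\upharpoonright\{\omega^\odot,\xi^\odot\}\text{ is uniformly continuous}\}$$ is the maximal subset $S$ of $\mathcal U(E^{\bar\odot})$ containing $\omega^\odot$ for which $\mathfrak U\upharpoonright S$ is uniformly continuous (i.e. it is itself such a subset, and it contains every other such subset). Consequently, $(E^{\bar\odot},\omega^\odot)$ has a unique maximal completely spatial subsystem, namely the subsystem $({E^{\mathcal U_\omega}}^{\bar\odot},\omega^\odot)$ generated (with norm closure) by $\mathcal U_\omega(E^{\bar\odot})$.
   Context: $\mathcal B$ is a unital $C^*$-algebra. A Hilbert $\mathcal B$-$\mathcal B$-module is a (right) Hilbert $\mathcal B$-module with a unital representation of $\mathcal B$ by adjointable operators. $\odot$ denotes the interior tensor product, $\langle x\odot y,x'\odot y'\rangle=\langle y,\langle x,x'\rangle y'\rangle$, and $\bar\odot$ its completion. A product system of Hilbert modules is a family $E^{\bar\odot}=(E_t)_{t\ge0}$ of Hilbert $\mathcal B$-$\mathcal B$-modules with $E_0=\mathcal B$ and two-sided unitaries $E_s\bar\odot E_t\to E_{s+t}$ (used as identifications) which are associative and are the canonical ones for $s=0$ or $t=0$. A subsystem is a family of $\mathcal B$-$\mathcal B$-submodules $E'_t\subset E_t$ with $E'_s\bar\odot E'_t=E'_{s+t}$ by restriction. A unit is a family $\xi^\odot=(\xi_t)_{t\ge0}$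 with $\xi_t\in E_t$, $\xi_s\odot\xi_t=\xi_{s+t}$, $\xi_0=\mathbf 1$; $\mathcal U(E^{\bar\odot})$ is the set of all units. A unit is unital if $\langle\xi_t,\xi_t\rangle=\mathbf 1$ for all $t$, and central if $b\xi_t=\xi_tb$ for all $b\in\mathcal B$, $t\ge 0$. A spatial product system is a pair $(E^{\bar\odot},\omega^\odot)$ with $\omega^\odot$ a central unital unit (the reference unit); a spatial subsystem is a subsystem containing $\omega^\odot$, with $\omega^\odot$ as reference unit. For units put $\mathfrak U_t^{\xi,\xi'}(b)=\langle\xi_t,b\xi'_t\rangle$; for fixed $\xi^\odot,\xi'^\odot$ this is a semigroup of bounded maps on $\mathcal B$. For a set $S$ of units, $\mathfrak U\upharpoonright S$ is uniformly continuous (and $S$ is called continuous) if $t\mapsto\mathfrak U_t^{\xi,\xi'}$ is a uniformly (norm) continuous semigroup on $\mathcal B$ for all $\xi^\odot,\xi'^\odot\in S$. The subsystem generated by $S$ (with norm closure) consists of the norm closures of $E^S_t=\operatorname{span}\{b_n\xi^n_{t_n}\odot\dots\odot b_1\xi^1_{t_1}b_0:\ n\in\mathbb N,\ b_i\in\mathcal B,\ {\xi^i}^\odot\in S,\ t_n+\dots+t_1=t\}$. A spatial product system is completely spatial if it is generated (with norm closure) by some continuous set $S$ of units with $\omega^\odot\in S$. *)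

theory Defs
  imports "HOL-Analysis.Analysis"
begin

text \<open>Unitality is understood to include \<open>1 \<noteq> 0\<close>. The real scalar multiplication inherited from the
  library is the restriction of the complex one.\<close>

class unital_cstar_algebra = real_normed_algebra_1 + banach +
  fixes scaleC :: "complex \<Rightarrow> 'a \<Rightarrow> 'a"
    and star :: "'a \<Rightarrow> 'a"
  assumes scaleC_add_right: "scaleC c (x + y) = scaleC c x + scaleC c y"
    and scaleC_add_left: "scaleC (c + d) x = scaleC c x + scaleC d x"
    and scaleC_scaleC: "scaleC c (scaleC d x) = scaleC (c * d) x"
    and scaleC_of_real: "scaleC (complex_of_real r) x = scaleR r x"
    and mult_scaleC_left: "scaleC c x * y = scaleC c (x * y)"
    and mult_scaleC_right: "x * scaleC c y = scaleC c (x * y)"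
    and norm_scaleC: "norm (scaleC c x) = cmod c * norm x"
    and star_star: "star (star x) = x"
    and star_add: "star (x + y) = star x + star y"
    and star_scaleC: "star (scaleC c x) = scaleC (cnj c) (star x)"
    and star_mult: "star (x * y) = star y * star x"
    and cstar_identity: "norm (star x * x) = (norm x)\<^sup>2"

text \<open>Modules live on a carrier set inside a type, since a product system is a family of modules
  indexed by a real number. The complex scalar multiplication is \<open>x \<mapsto> x (c 1)\<close>.\<close>

record ('b, 'e) bimodule_data =
  carrier :: "'e set"
  mzero :: 'e
  madd :: "'e \<Rightarrow> 'e \<Rightarrow> 'e"
  lmul :: "'b \<Rightarrow> 'e \<Rightarrow> 'e"
  rmul :: "'e \<Rightarrow> 'b \<Rightarrow> 'e"
  ip :: "'e \<Rightarrow> 'e \<Rightarrow> 'b"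

definition mscale ::
  "('b::unital_cstar_algebra, 'e) bimodule_data \<Rightarrow> complex \<Rightarrow> 'e \<Rightarrow> 'e"
  where "mscale M c x = rmul M x (scaleC c 1)"

definition mminus ::
  "('b::unital_cstar_algebra, 'e) bimodule_data \<Rightarrow> 'e \<Rightarrow> 'e \<Rightarrow> 'e"
  where "mminus M x y = madd M x (mscale M (-1) y)"

definition bnorm :: "('b::unital_cstar_algebra, 'e) bimodule_data \<Rightarrow> 'e \<Rightarrow> real"
  where "bnorm M x = sqrt (norm (ip M x x))"

text \<open>The locale \<^locale>\<open>Metric_space\<close> requires symmetry also off the carrier, hence the
  default value 0 there. Its triangle inequality, part of the axiom \<open>metric\<close> below, follows from
  the algebraic axioms by the Cauchy-Schwarz inequality.\<close>

definition bdist :: "('b::unital_cstar_algebra, 'e) bimodule_data \<Rightarrow> 'e \<Rightarrow> 'e \<Rightarrow> real"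
  where "bdist M x y = (if x \<in> carrier M \<and> y \<in> carrier M then bnorm M (mminus M x y) else 0)"

locale hilbert_module =
  fixes M :: "('b::unital_cstar_algebra, 'e) bimodule_data"
  assumes zero_closed: "mzero M \<in> carrier M"
    and add_closed: "\<lbrakk>x \<in> carrier M; y \<in> carrier M\<rbrakk> \<Longrightarrow> madd M x y \<in> carrier M"
    and rmul_closed: "x \<in> carrier M \<Longrightarrow> rmul M x b \<in> carrier M"
    and add_assoc: "\<lbrakk>x \<in> carrier M; y \<in> carrier M; z \<in> carrier M\<rbrakk>
      \<Longrightarrow> madd M (madd M x y) z = madd M x (madd M y z)"
    and add_commute: "\<lbrakk>x \<in> carrier M; y \<in> carrier M\<rbrakk> \<Longrightarrow> madd M x y = madd M y x"
    and add_zero: "x \<in> carrier M \<Longrightarrow> madd M x (mzero M) = x"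
    and add_inverse: "x \<in> carrier M \<Longrightarrow> \<exists>y\<in>carrier M. madd M x y = mzero M"
    and rmul_add_left: "\<lbrakk>x \<in> carrier M; y \<in> carrier M\<rbrakk>
      \<Longrightarrow> rmul M (madd M x y) b = madd M (rmul M x b) (rmul M y b)"
    and rmul_add_right: "x \<in> carrier M
      \<Longrightarrow> rmul M x (b + c) = madd M (rmul M x b) (rmul M x c)"
    and rmul_rmul: "x \<in> carrier M \<Longrightarrow> rmul M (rmul M x b) c = rmul M x (b * c)"
    and rmul_one: "x \<in> carrier M \<Longrightarrow> rmul M x 1 = x"
    and ip_add_right: "\<lbrakk>x \<in> carrier M; y \<in> carrier M; z \<in> carrier M\<rbrakk>
      \<Longrightarrow> ip M x (madd M y z) = ip M x y + ip M x z"
    and ip_rmul_right: "\<lbrakk>x \<in> carrier M; y \<in> carrier M\<rbrakk>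
      \<Longrightarrow> ip M x (rmul M y b) = ip M x y * b"
    and star_ip: "\<lbrakk>x \<in> carrier M; y \<in> carrier M\<rbrakk> \<Longrightarrow> star (ip M x y) = ip M y x"
    and ip_positive: "x \<in> carrier M \<Longrightarrow> \<exists>c. ip M x x = star c * c"
    and ip_definite: "\<lbrakk>x \<in> carrier M; ip M x x = 0\<rbrakk> \<Longrightarrow> x = mzero M"
    and metric: "Metric_space (carrier M) (bdist M)"
    and complete: "Metric_space.mcomplete (carrier M) (bdist M)"

text \<open>The axioms \<open>lmul_mult\<close> to \<open>lmul_adjoint\<close> say that \<^const>\<open>lmul\<close> is a unital
  *-homomorphism into the adjointable operators on \<open>M\<close>; \<open>lmul_scaleC\<close> is its complex
  homogeneity, which does not follow from the rest.\<close>

locale hilbert_bimodule = hilbert_module M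
  for M :: "('b::unital_cstar_algebra, 'e) bimodule_data" +
  assumes lmul_closed: "x \<in> carrier M \<Longrightarrow> lmul M b x \<in> carrier M"
    and lmul_add_right: "\<lbrakk>x \<in> carrier M; y \<in> carrier M\<rbrakk>
      \<Longrightarrow> lmul M b (madd M x y) = madd M (lmul M b x) (lmul M b y)"
    and lmul_rmul: "x \<in> carrier M \<Longrightarrow> lmul M b (rmul M x c) = rmul M (lmul M b x) c"
    and lmul_mult: "x \<in> carrier M \<Longrightarrow> lmul M (b * c) x = lmul M b (lmul M c x)"
    and lmul_one: "x \<in> carrier M \<Longrightarrow> lmul M 1 x = x"
    and lmul_add_left: "x \<in> carrier M
      \<Longrightarrow> lmul M (b + c) x = madd M (lmul M b x) (lmul M c x)"
    and lmul_scaleC: "x \<in> carrier M \<Longrightarrow> lmul M (scaleC k b) x = mscale M k (lmul M b x)"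
    and lmul_adjoint: "\<lbrakk>x \<in> carrier M; y \<in> carrier M\<rbrakk>
      \<Longrightarrow> ip M x (lmul M b y) = ip M (lmul M (star b) x) y"

definition algebra_bimodule :: "('b::unital_cstar_algebra, 'b) bimodule_data"
  where "algebra_bimodule =
    \<lparr>carrier = UNIV, mzero = 0, madd = (+), lmul = (*), rmul = (*), ip = (\<lambda>a b. star a * b)\<rparr>"

definition two_sided_unitary ::
  "('b::unital_cstar_algebra, 'd) bimodule_data \<Rightarrow> ('b, 'e) bimodule_data \<Rightarrow> ('d \<Rightarrow> 'e) \<Rightarrow> bool"
  where "two_sided_unitary M N u \<longleftrightarrow>
    bij_betw u (carrier M) (carrier N) \<and>
    (\<forall>x\<in>carrier M. \<forall>y\<in>carrier M. u (madd M x y) = madd N (u x) (u y)) \<and>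
    (\<forall>x\<in>carrier M. \<forall>b. u (lmul M b x) = lmul N b (u x)) \<and>
    (\<forall>x\<in>carrier M. \<forall>b. u (rmul M x b) = rmul N (u x) b) \<and>
    (\<forall>x\<in>carrier M. \<forall>y\<in>carrier M. ip N (u x) (u y) = ip M x y)"

inductive_set mspan ::
  "('b::unital_cstar_algebra, 'e) bimodule_data \<Rightarrow> 'e set \<Rightarrow> 'e set"
  for M :: "('b, 'e) bimodule_data" and A :: "'e set"
  where
    zero: "mzero M \<in> mspan M A"
  | base: "x \<in> A \<Longrightarrow> x \<in> mspan M A"
  | add: "\<lbrakk>x \<in> mspan M A; y \<in> mspan M A\<rbrakk> \<Longrightarrow> madd M x y \<in> mspan M A"
  | scale: "x \<in> mspan M A \<Longrightarrow> mscale M c x \<in> mspan M A"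

definition mclosure ::
  "('b::unital_cstar_algebra, 'e) bimodule_data \<Rightarrow> 'e set \<Rightarrow> 'e set"
  where "mclosure M A = (Metric_space.mtopology (carrier M) (bdist M)) closure_of A"

abbreviation submodule_on ::
  "('b, 'e) bimodule_data \<Rightarrow> 'e set \<Rightarrow> ('b, 'e) bimodule_data"
  where "submodule_on M A \<equiv> M\<lparr>carrier := A\<rparr>"

text \<open>\<open>T\<close>, with elementary tensors \<open>x \<odot> y = tens x y\<close>, is the completion of the interior tensor
  product of \<open>M\<close> and \<open>N\<close>: the inner product of elementary tensors is the prescribed one, the left
  action is \<open>b (x \<odot> y) = b x \<odot> y\<close>, and the span of the elementary tensors is dense in the Hilbert
  module \<open>T\<close>. Biadditivity, balancedness \<open>x b \<odot> y = x \<odot> b y\<close> and \<open>(x \<odot> y) b = x \<odot> y b\<close> follow from the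
  inner product formula, as \<^const>\<open>ip\<close> is definite. A pair \<open>(T, tens)\<close> is thus the same thing as a
  two-sided unitary from the completed interior tensor product onto \<open>T\<close>.\<close>

definition interior_tensor ::
  "('b::unital_cstar_algebra, 'm) bimodule_data \<Rightarrow> ('b, 'n) bimodule_data
    \<Rightarrow> ('b, 't) bimodule_data \<Rightarrow> ('m \<Rightarrow> 'n \<Rightarrow> 't) \<Rightarrow> bool"
  where "interior_tensor M N T tens \<longleftrightarrow>
    hilbert_bimodule M \<and> hilbert_bimodule N \<and> hilbert_bimodule T \<and>
    (\<forall>x\<in>carrier M. \<forall>y\<in>carrier N. tens x y \<in> carrier T) \<and>
    (\<forall>x\<in>carrier M. \<forall>y\<in>carrier N. \<forall>x'\<in>carrier M. \<forall>y'\<in>carrier N.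
      ip T (tens x y) (tens x' y') = ip N y (lmul N (ip M x x') y')) \<and>
    (\<forall>x\<in>carrier M. \<forall>y\<in>carrier N. \<forall>b. lmul T b (tens x y) = tens (lmul M b x) y) \<and>
    mclosure T (mspan T {tens x y |x y. x \<in> carrier M \<and> y \<in> carrier N}) = carrier T"

text \<open>\<open>tens P s t x y\<close> is the image of \<open>x \<odot> y\<close> under the unitary onto \<open>E\<^sub>s\<^sub>+\<^sub>t\<close>, and \<open>unit0 P\<close> is the
  identification of the algebra with \<open>E\<^sub>0\<close>. Only fibres with nonnegative index matter.\<close>

record ('b, 'e) product_system_data =
  fibre :: "real \<Rightarrow> ('b, 'e) bimodule_data"
  tens :: "real \<Rightarrow> real \<Rightarrow> 'e \<Rightarrow> 'e \<Rightarrow> 'e"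
  unit0 :: "'b \<Rightarrow> 'e"

locale product_system =
  fixes P :: "('b::unital_cstar_algebra, 'e) product_system_data"
  assumes fibres: "0 \<le> t \<Longrightarrow> hilbert_bimodule (fibre P t)"
    and fibre_zero: "two_sided_unitary algebra_bimodule (fibre P 0) (unit0 P)"
    and tensor: "\<lbrakk>0 \<le> s; 0 \<le> t\<rbrakk>
      \<Longrightarrow> interior_tensor (fibre P s) (fibre P t) (fibre P (s + t)) (tens P s t)"
    and tens_assoc: "\<lbrakk>0 \<le> r; 0 \<le> s; 0 \<le> t;
        x \<in> carrier (fibre P r); y \<in> carrier (fibre P s); z \<in> carrier (fibre P t)\<rbrakk>
      \<Longrightarrow> tens P (r + s) t (tens P r s x y) z = tens P r (s + t) x (tens P s t y z)"
    and tens_zero_left: "\<lbrakk>0 \<le> t; x \<in> carrier (fibre P t)\<rbrakk>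
      \<Longrightarrow> tens P 0 t (unit0 P b) x = lmul (fibre P t) b x"
    and tens_zero_right: "\<lbrakk>0 \<le> t; x \<in> carrier (fibre P t)\<rbrakk>
      \<Longrightarrow> tens P t 0 x (unit0 P b) = rmul (fibre P t) x b"

text \<open>Families indexed by \<open>t \<ge> 0\<close> are functions on the reals that are extensional on \<^term>\<open>{0::real..}\<close>,
  so that equality of functions is equality of families.\<close>

definition restrict_system ::
  "('b, 'e) product_system_data \<Rightarrow> (real \<Rightarrow> 'e set) \<Rightarrow> ('b, 'e) product_system_data"
  where "restrict_system P F = P\<lparr>fibre := \<lambda>t. submodule_on (fibre P t) (F t)\<rparr>"

definition subsystem ::
  "('b::unital_cstar_algebra, 'e) product_system_data \<Rightarrow> (real \<Rightarrow> 'e set) \<Rightarrow> bool"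
  where "subsystem P F \<longleftrightarrow>
    F \<in> extensional {0..} \<and>
    (\<forall>t\<ge>0. F t \<subseteq> carrier (fibre P t) \<and> hilbert_bimodule (submodule_on (fibre P t) (F t))) \<and>
    (\<forall>s\<ge>0. \<forall>t\<ge>0. interior_tensor (submodule_on (fibre P s) (F s)) (submodule_on (fibre P t) (F t))
      (submodule_on (fibre P (s + t)) (F (s + t))) (tens P s t))"

definition units ::
  "('b::unital_cstar_algebra, 'e) product_system_data \<Rightarrow> (real \<Rightarrow> 'e) set"
  where "units P = {\<xi> \<in> (\<Pi>\<^sub>E t\<in>{0..}. carrier (fibre P t)).
    \<xi> 0 = unit0 P 1 \<and> (\<forall>s\<ge>0. \<forall>t\<ge>0. tens P s t (\<xi> s) (\<xi> t) = \<xi> (s + t))}"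

definition unital_unit ::
  "('b::unital_cstar_algebra, 'e) product_system_data \<Rightarrow> (real \<Rightarrow> 'e) \<Rightarrow> bool"
  where "unital_unit P \<xi> \<longleftrightarrow> (\<forall>t\<ge>0. ip (fibre P t) (\<xi> t) (\<xi> t) = 1)"

definition central_unit ::
  "('b::unital_cstar_algebra, 'e) product_system_data \<Rightarrow> (real \<Rightarrow> 'e) \<Rightarrow> bool"
  where "central_unit P \<xi> \<longleftrightarrow> (\<forall>t\<ge>0. \<forall>b. lmul (fibre P t) b (\<xi> t) = rmul (fibre P t) (\<xi> t) b)"

definition spatial_product_system ::
  "('b::unital_cstar_algebra, 'e) product_system_data \<Rightarrow> (real \<Rightarrow> 'e) \<Rightarrow> bool"
  where "spatial_product_system P \<omega> \<longleftrightarrow>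
    product_system P \<and> \<omega> \<in> units P \<and> unital_unit P \<omega> \<and> central_unit P \<omega>"

definition spatial_subsystem ::
  "('b::unital_cstar_algebra, 'e) product_system_data \<Rightarrow> (real \<Rightarrow> 'e) \<Rightarrow> (real \<Rightarrow> 'e set) \<Rightarrow> bool"
  where "spatial_subsystem P \<omega> F \<longleftrightarrow> subsystem P F \<and> (\<forall>t\<ge>0. \<omega> t \<in> F t)"

definition unit_semigroup ::
  "('b::unital_cstar_algebra, 'e) product_system_data
    \<Rightarrow> (real \<Rightarrow> 'e) \<Rightarrow> (real \<Rightarrow> 'e) \<Rightarrow> real \<Rightarrow> 'b \<Rightarrow> 'b"
  where "unit_semigroup P \<xi> \<xi>' t b = ip (fibre P t) (\<xi> t) (lmul (fibre P t) b (\<xi>' t))"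

text \<open>Uniform continuity of a semigroup is continuity for the operator norm.\<close>

definition uniformly_continuous_semigroup ::
  "(real \<Rightarrow> 'b \<Rightarrow> 'b::real_normed_vector) \<Rightarrow> bool"
  where "uniformly_continuous_semigroup T \<longleftrightarrow>
    (\<forall>t\<ge>0. bounded_linear (T t)) \<and>
    T 0 = id \<and> (\<forall>s\<ge>0. \<forall>t\<ge>0. T (s + t) = T s \<circ> T t) \<and>
    continuous_on {0..} (\<lambda>t. Blinfun (T t))"

definition continuous_units ::
  "('b::unital_cstar_algebra, 'e) product_system_data \<Rightarrow> (real \<Rightarrow> 'e) set \<Rightarrow> bool"
  where "continuous_units P S \<longleftrightarrow>
    (\<forall>\<xi>\<in>S. \<forall>\<xi>'\<in>S. uniformly_continuous_semigroup (unit_semigroup P \<xi> \<xi>'))"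

text \<open>\<open>word P [(b\<^sub>n, \<xi>\<^sup>n, t\<^sub>n), \<dots>, (b\<^sub>1, \<xi>\<^sup>1, t\<^sub>1)] b\<^sub>0\<close> is
  \<open>b\<^sub>n \<xi>\<^sup>n \<odot> \<dots> \<odot> b\<^sub>1 \<xi>\<^sup>1 b\<^sub>0\<close>; the trailing \<open>b\<^sub>0\<close> is appended as the element \<open>unit0 P b\<^sub>0\<close> of
  \<open>E\<^sub>0\<close>, using \<open>x \<odot> b\<^sub>0 = x b\<^sub>0\<close>.\<close>

definition total_time :: "('b \<times> (real \<Rightarrow> 'e) \<times> real) list \<Rightarrow> real"
  where "total_time w = (\<Sum>(b, \<xi>, t)\<leftarrow>w. t)"

fun word ::
  "('b, 'e) product_system_data \<Rightarrow> ('b \<times> (real \<Rightarrow> 'e) \<times> real) list \<Rightarrow> 'b \<Rightarrow> 'e"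
  where
    "word P [] b\<^sub>0 = unit0 P b\<^sub>0"
  | "word P ((b, \<xi>, t) # w) b\<^sub>0 =
      tens P t (total_time w) (lmul (fibre P t) b (\<xi> t)) (word P w b\<^sub>0)"

definition generated ::
  "('b::unital_cstar_algebra, 'e) product_system_data
    \<Rightarrow> (real \<Rightarrow> 'e) set \<Rightarrow> real \<Rightarrow> 'e set"
  where "generated P S = (\<lambda>t\<in>{0..}. mclosure (fibre P t) (mspan (fibre P t)
    {word P w b\<^sub>0 |w b\<^sub>0. (\<forall>(b, \<xi>, r)\<in>set w. \<xi> \<in> S \<and> 0 \<le> r) \<and> total_time w = t}))"

definition completely_spatial ::
  "('b::unital_cstar_algebra, 'e) product_system_data \<Rightarrow> (real \<Rightarrow> 'e) \<Rightarrow> bool"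
  where "completely_spatial P \<omega> \<longleftrightarrow>
    spatial_product_system P \<omega> \<and>
    (\<exists>S\<subseteq>units P. \<omega> \<in> S \<and> continuous_units P S \<and>
      (\<forall>t\<ge>0. generated P S t = carrier (fibre P t)))"

definition completely_spatial_subsystem ::
  "('b::unital_cstar_algebra, 'e) product_system_data \<Rightarrow> (real \<Rightarrow> 'e) \<Rightarrow> (real \<Rightarrow> 'e set) \<Rightarrow> bool"
  where "completely_spatial_subsystem P \<omega> F \<longleftrightarrow>
    spatial_subsystem P \<omega> F \<and> completely_spatial (restrict_system P F) \<omega>"

definition maximal_completely_spatial_subsystem ::
  "('b::unital_cstar_algebra, 'e) product_system_data \<Rightarrow> (real \<Rightarrow> 'e) \<Rightarrow> (real \<Rightarrow> 'e set) \<Rightarrow> bool"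
  where "maximal_completely_spatial_subsystem P \<omega> F \<longleftrightarrow>
    completely_spatial_subsystem P \<omega> F \<and>
    (\<forall>G. completely_spatial_subsystem P \<omega> G \<longrightarrow> (\<forall>t\<ge>0. F t \<subseteq> G t) \<longrightarrow> G = F)"

definition units_continuous_with ::
  "('b::unital_cstar_algebra, 'e) product_system_data \<Rightarrow> (real \<Rightarrow> 'e) \<Rightarrow> (real \<Rightarrow> 'e) set"
  where "units_continuous_with P \<omega> = {\<xi> \<in> units P. continuous_units P {\<omega>, \<xi>}}"

end

theory Submission
  imports Defs
begin

text \<open>The heart of the matter is that continuity with respect to the reference unit is transitive.
  For a unit \<open>\<xi>\<close> with \<open>\<UU>\<close> uniformly continuous on \<open>{\<omega>, \<xi>}\<close>, expanding the square
  \<open>\<langle>\<xi>\<^sub>t - \<omega>\<^sub>t, \<xi>\<^sub>t - \<omega>\<^sub>t\<rangle>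
     = \<langle>\<xi>\<^sub>t, \<xi>\<^sub>t\<rangle> - \<langle>\<xi>\<^sub>t, \<omega>\<^sub>t\<rangle> - \<langle>\<omega>\<^sub>t, \<xi>\<^sub>t\<rangle> + \<langle>\<omega>\<^sub>t, \<omega>\<^sub>t\<rangle>\<close>
  shows that the distance of \<open>\<xi>\<^sub>t\<close> to \<open>\<omega>\<^sub>t\<close> depends continuously on \<open>t\<close> and vanishes at \<open>0\<close>. For a
  second such unit \<open>\<eta>\<close> the decomposition
  \<open>\<langle>\<xi>\<^sub>t, b \<eta>\<^sub>t\<rangle> - b = \<langle>\<xi>\<^sub>t - \<omega>\<^sub>t, b \<eta>\<^sub>t\<rangle> + (\<langle>\<omega>\<^sub>t, b \<eta>\<^sub>t\<rangle> - b)\<close>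
  then bounds \<open>\<UU>\<^sub>t - id\<close> for the pair \<open>(\<xi>, \<eta>)\<close> by a quantity tending to \<open>0\<close>, uniformly for \<open>b\<close> in the
  unit ball; for a semigroup that is locally bounded this already gives norm continuity everywhere.
  Maximality of the set of all such units is then immediate.\<close>

text \<open>The estimates need only that the inner product and the left action are bounded, with any
  constants. This leaves room for elementary proofs: a Cauchy-Schwarz inequality with constant
  \<open>2\<close> follows from the triangle inequality of the module norm by polarization, and the left action
  is bounded because a selfadjoint element of small norm is the average of two unitaries, which
  act isometrically.\<close>

text \<open>For the second half, the closed spans of words in the units of a set \<open>S\<close> form a subsystem:
  words are stable under both actions, the product of two words is a word, and, since a unit at
  time \<open>s + t\<close> factors, every word of length \<open>s + t\<close> is a product of words of lengths \<open>s\<close> and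
  \<open>t\<close>; boundedness of all operations carries this over to the closures. A completely spatial
  subsystem is generated by a continuous set of its own units, computed equally well in the
  ambient system, so it lies in the subsystem generated by the maximal continuous set. That
  subsystem is thus the largest completely spatial one, and hence the only maximal one.\<close>

section \<open>Elementary facts on the involution\<close>

lemma star_zero: "star (0::'a::unital_cstar_algebra) = 0"
  using star_add[of "0::'a" 0] by simp

lemma star_minus: "star (- x) = - star (x::'a::unital_cstar_algebra)"
  using star_add[of x "- x"] by (simp add: star_zero eq_neg_iff_add_eq_0 add.commute)

lemma star_diff: "star (x - y) = star x - star (y::'a::unital_cstar_algebra)"
  using star_add[of x "- y"] by (simp add: star_minus)

lemma star_one: "star (1::'a::unital_cstar_algebra) = 1"
  using star_mult[of "star (1::'a)" 1] by (simp add: star_star)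

lemma star_scaleR: "star (r *\<^sub>R x) = r *\<^sub>R star (x::'a::unital_cstar_algebra)"
  using star_scaleC[of "complex_of_real r" x] by (simp add: scaleC_of_real)

lemma norm_star: "norm (star x) = norm (x::'a::unital_cstar_algebra)"
proof -
  have le: "norm y \<le> norm (star y)" for y :: 'a
    using norm_mult_ineq[of "star y" y] by (cases "y = 0") (auto simp: cstar_identity power2_eq_square)
  from le[of x] le[of "star x"] show ?thesis by (simp add: star_star)
qed

lemma bounded_linear_star: "bounded_linear (star :: 'a::unital_cstar_algebra \<Rightarrow> 'a)"
  by (rule bounded_linear_intro[where K = 1]) (simp_all add: star_add star_scaleR norm_star)

lemma scaleC_minus_one: "scaleC (- 1) x = - (x::'a::unital_cstar_algebra)"
  using scaleC_of_real[of "- 1" x] by simp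

text \<open>Writing \<open>a = 1 - y\<close>, the equation \<open>a\<^sup>2 = 1 - h\<^sup>2\<close> becomes the fixed point equation
  \<open>y = (h\<^sup>2 + y\<^sup>2) / 2\<close>, whose right-hand side is a contraction on the ball of radius \<open>1/2\<close>. The
  conditions of being selfadjoint and of commuting with \<open>h\<close> are closed and preserved by this map,
  so they pass to its fixed point.\<close>

lemma sqrt_one_minus_square_exists:
  fixes h :: "'a::unital_cstar_algebra"
  assumes sa: "star h = h" and small: "norm h \<le> 1/2"
  obtains a where "star a = a" "h * a = a * h" "a * a = 1 - h * h"
proof -
  define X where "X = cball 0 (1/2) \<inter> {y. star y = y} \<inter> {y. h * y = y * h}"
  define f where "f y = (1/2) *\<^sub>R (h * h + y * y)" for y
  have hh: "norm (h * h) \<le> 1/4"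
    using norm_mult_ineq[of h h] mult_mono[OF small small] by simp
  have cont: "continuous_on UNIV (star :: 'a \<Rightarrow> 'a)"
    by (rule linear_continuous_on[OF bounded_linear_star])
  have "closed {y. star y = (y::'a)}"
    by (rule closed_Collect_eq[OF cont continuous_on_id])
  moreover have "closed {y. h * y = y * h}"
    by (intro closed_Collect_eq continuous_intros)
  ultimately have "complete X"
    unfolding X_def complete_eq_closed by (intro closed_Int closed_cball)
  moreover have "0 \<in> X" by (simp add: X_def star_zero)
  moreover have "f ` X \<subseteq> X"
  proof (rule image_subsetI)
    fix y assume y: "y \<in> X"
    then have ny: "norm y \<le> 1/2" and sy: "star y = y" and cy: "h * y = y * h"
      by (auto simp: X_def)
    have "norm (y * y) \<le> 1/4"
      using norm_mult_ineq[of y y] mult_mono[OF ny ny] by simp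
    with hh have "norm (f y) \<le> 1/2"
      using norm_triangle_ineq[of "h * h" "y * y"] by (simp add: f_def)
    moreover have "h * (y * y) = y * y * h"
      by (metis cy mult.assoc)
    ultimately show "f y \<in> X"
      by (simp add: X_def f_def star_scaleR star_add star_mult sa sy algebra_simps)
  qed
  moreover have "dist (f y) (f z) \<le> 1/2 * dist y z" if "y \<in> X" "z \<in> X" for y z
  proof -
    have "f y - f z = (1/2) *\<^sub>R (y * (y - z) + (y - z) * z)"
      by (simp add: f_def algebra_simps)
    then have "norm (f y - f z) \<le> 1/2 * (norm y * norm (y - z) + norm (y - z) * norm z)"
      using norm_triangle_ineq[of "y * (y - z)" "(y - z) * z"]
        norm_mult_ineq[of y "y - z"] norm_mult_ineq[of "y - z" z] by simp
    also have "\<dots> \<le> 1/2 * (1/2 * norm (y - z) + norm (y - z) * (1/2))"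
      using that by (intro mult_left_mono add_mono mult_right_mono) (auto simp: X_def)
    finally show ?thesis by (simp add: dist_norm)
  qed
  ultimately have "\<exists>!y. y \<in> X \<and> f y = y"
    by (intro Banach_fix[where c = "1/2"]) auto
  then obtain y where y: "y \<in> X" "f y = y" by blast
  have "h * h + y * y = 2 *\<^sub>R f y" by (simp add: f_def)
  also have "\<dots> = y + y" by (simp add: y scaleR_2)
  finally have "(1 - y) * (1 - y) = 1 - h * h"
    by (simp add: algebra_simps)
  with y show thesis
    by (intro that[of "1 - y"]) (auto simp: X_def star_diff star_one algebra_simps)
qed

section \<open>Hilbert modules: norm estimates\<close>

context hilbert_module
begin

lemma ip_add_left:
  assumes "x \<in> carrier M" "y \<in> carrier M" "z \<in> carrier M"
  shows "ip M (madd M x y) z = ip M x z + ip M y z"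
  using assms star_ip[of z "madd M x y"] star_ip[of z x] star_ip[of z y]
  by (simp add: add_closed ip_add_right star_add)

lemma ip_rmul_left:
  assumes "x \<in> carrier M" "y \<in> carrier M"
  shows "ip M (rmul M x b) y = star b * ip M x y"
  using assms star_ip[of y "rmul M x b"] star_ip[of y x]
  by (simp add: rmul_closed ip_rmul_right star_mult)

lemma mscale_closed: "x \<in> carrier M \<Longrightarrow> mscale M c x \<in> carrier M"
  by (simp add: mscale_def rmul_closed)

lemma mminus_closed: "\<lbrakk>x \<in> carrier M; y \<in> carrier M\<rbrakk> \<Longrightarrow> mminus M x y \<in> carrier M"
  by (simp add: mminus_def add_closed mscale_closed)

lemmas closed_rules = zero_closed add_closed rmul_closed mscale_closed mminus_closed

lemma ip_minus_right:
  "\<lbrakk>x \<in> carrier M; y \<in> carrier M; z \<in> carrier M\<rbrakk>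
    \<Longrightarrow> ip M x (mminus M y z) = ip M x y - ip M x z"
  by (simp add: mminus_def mscale_def scaleC_minus_one ip_add_right ip_rmul_right rmul_closed)

lemma ip_minus_left:
  "\<lbrakk>x \<in> carrier M; y \<in> carrier M; z \<in> carrier M\<rbrakk>
    \<Longrightarrow> ip M (mminus M x y) z = ip M x z - ip M y z"
  by (simp add: mminus_def mscale_def scaleC_minus_one ip_add_left ip_rmul_left rmul_closed
      star_minus star_one)

lemma ip_zero_right: "x \<in> carrier M \<Longrightarrow> ip M x (mzero M) = 0"
  using ip_add_right[of x "mzero M" "mzero M"] by (simp add: zero_closed add_zero)

lemma ip_zero_left: "x \<in> carrier M \<Longrightarrow> ip M (mzero M) x = 0"
  using ip_add_left[of "mzero M" "mzero M" x] by (simp add: zero_closed add_zero)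

lemmas ip_simps = ip_add_left ip_add_right ip_rmul_left ip_rmul_right ip_minus_left ip_minus_right
  ip_zero_left ip_zero_right

lemma rmul_zero: "x \<in> carrier M \<Longrightarrow> rmul M x 0 = mzero M"
  by (rule ip_definite) (simp_all add: closed_rules ip_simps)

lemma add_mscale_minus_one:
  assumes "y \<in> carrier M"
  shows "madd M (mscale M (- 1) y) y = mzero M"
proof -
  have "madd M (mscale M (- 1) y) y = madd M (rmul M y (- 1)) (rmul M y 1)"
    using assms by (simp add: mscale_def scaleC_minus_one rmul_one)
  also have "\<dots> = mzero M"
    using assms rmul_add_right[of y "- 1" 1] by (simp add: rmul_zero)
  finally show ?thesis .
qed

text \<open>Identities between module elements are verified by computing inner products: \<open>x - y\<close> is
  orthogonal to \<open>x\<close> and to \<open>y\<close>, hence to itself.\<close>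

lemma eq_by_ip:
  assumes x: "x \<in> carrier M" and y: "y \<in> carrier M"
    and "ip M x x = ip M x y" "ip M y x = ip M y y"
  shows "x = y"
proof -
  have "mminus M x y = mzero M"
    using assms by (intro ip_definite) (simp_all add: closed_rules ip_simps)
  have "x = madd M x (madd M (mscale M (- 1) y) y)"
    using x y by (simp add: add_mscale_minus_one add_zero)
  also have "\<dots> = madd M (mminus M x y) y"
    using x y by (simp add: mminus_def add_assoc closed_rules)
  also have "\<dots> = y"
    using y \<open>mminus M x y = mzero M\<close> by (simp add: add_commute zero_closed add_zero)
  finally show ?thesis .
qed

lemma bnorm_nonneg: "0 \<le> bnorm M x"
  by (simp add: bnorm_def)

lemma bnorm_power2: "(bnorm M x)\<^sup>2 = norm (ip M x x)"
  by (simp add: bnorm_def)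

lemma bnorm_eq_0: "x \<in> carrier M \<Longrightarrow> bnorm M x = 0 \<longleftrightarrow> x = mzero M"
  using ip_definite by (auto simp: bnorm_def ip_zero_right zero_closed)

lemma bnorm_rmul_le:
  assumes "x \<in> carrier M"
  shows "bnorm M (rmul M x b) \<le> bnorm M x * norm b"
proof -
  obtain c where c: "ip M x x = star c * c" using ip_positive[OF assms] by blast
  have "ip M (rmul M x b) (rmul M x b) = star (c * b) * (c * b)"
    using assms by (simp add: ip_simps closed_rules c star_mult mult.assoc)
  then have "bnorm M (rmul M x b) = norm (c * b)"
    by (simp add: bnorm_def cstar_identity)
  moreover have "bnorm M x = norm c"
    by (simp add: bnorm_def c cstar_identity)
  ultimately show ?thesis by (simp add: norm_mult_ineq)
qed

lemma bnorm_mscale_le: "x \<in> carrier M \<Longrightarrow> bnorm M (mscale M c x) \<le> cmod c * bnorm M x"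
  using bnorm_rmul_le[of x "scaleC c 1"] by (simp add: mscale_def norm_scaleC mult.commute)

lemma bnorm_minus_triangle:
  assumes "x \<in> carrier M" "y \<in> carrier M" "z \<in> carrier M"
  shows "bnorm M (mminus M x z) \<le> bnorm M (mminus M x y) + bnorm M (mminus M y z)"
  using Metric_space.triangle[OF metric assms] assms by (simp add: bdist_def)

lemma bnorm_triangle:
  assumes x: "x \<in> carrier M" and y: "y \<in> carrier M"
  shows "bnorm M (madd M x y) \<le> bnorm M x + bnorm M y"
proof -
  let ?y = "mscale M (- 1) y"
  have "mminus M x ?y = madd M x y" "mminus M x (mzero M) = x"
    using x y by (auto intro!: eq_by_ip
        simp: closed_rules ip_simps mscale_def scaleC_minus_one star_minus star_one)
  moreover have "mminus M (mzero M) ?y = y"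
    using x y by (auto intro!: eq_by_ip
        simp: closed_rules ip_simps mscale_def scaleC_minus_one star_minus star_one)
  ultimately show ?thesis
    using bnorm_minus_triangle[of x "mzero M" ?y] x y by (simp add: closed_rules)
qed

lemma bnorm_minus_triangle_le:
  assumes x: "x \<in> carrier M" and y: "y \<in> carrier M"
  shows "bnorm M (mminus M x y) \<le> bnorm M x + bnorm M y"
  using bnorm_triangle[of x "mscale M (- 1) y"] bnorm_mscale_le[of y "- 1"] x y
  by (simp add: mminus_def closed_rules)

text \<open>Replacing \<open>y\<close> by a positive multiple \<open>z\<close> of \<open>y \<langle>y, x\<rangle>\<close> makes \<open>\<langle>x, z\<rangle>\<close> selfadjoint, so that
  \<open>4 \<langle>x, z\<rangle> = \<langle>x + z, x + z\<rangle> - \<langle>x - z, x - z\<rangle>\<close>, and the triangle inequality estimates the right-hand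
  side. The constant \<open>2\<close>, in place of the sharp \<open>1\<close>, is the price of this short argument.\<close>

lemma Cauchy_Schwarz:
  assumes x: "x \<in> carrier M" and y: "y \<in> carrier M"
  shows "norm (ip M x y) \<le> 2 * bnorm M x * bnorm M y"
proof (cases "ip M x y = 0 \<or> bnorm M x = 0 \<or> bnorm M y = 0")
  case True
  then show ?thesis
    using x y bnorm_eq_0 by (auto simp: ip_simps bnorm_nonneg)
next
  case False
  define n where "n = norm (ip M x y)"
  \<comment> \<open>With this \<open>t\<close> the bound for the norm of \<open>z\<close> is exactly the norm of \<open>x\<close>.\<close>
  define t where "t = bnorm M x / (bnorm M y * n)"
  define z where "z = rmul M y (t *\<^sub>R ip M y x)"
  have pos: "n > 0" "bnorm M x > 0" "bnorm M y > 0"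
    using False bnorm_nonneg[of x] bnorm_nonneg[of y] by (auto simp: n_def less_le)
  then have t: "t > 0" by (simp add: t_def)
  have z: "z \<in> carrier M" using y by (simp add: z_def closed_rules)
  have star_yx: "star (ip M y x) = ip M x y" using x y by (simp add: star_ip)
  have nyx: "norm (ip M y x) = n" by (metis n_def star_yx norm_star)
  have "bnorm M z \<le> bnorm M y * (t * n)"
    using bnorm_rmul_le[OF y, of "t *\<^sub>R ip M y x"] t by (simp add: z_def nyx)
  also have "\<dots> = bnorm M x" using pos by (simp add: t_def)
  finally have nz: "bnorm M z \<le> bnorm M x" .
  have le: "norm (ip M w w) \<le> 4 * (bnorm M x)\<^sup>2" if "bnorm M w \<le> bnorm M x + bnorm M z" for w
  proof -
    have "(bnorm M w)\<^sup>2 \<le> (2 * bnorm M x)\<^sup>2"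
      using that nz by (intro power_mono) (simp_all add: bnorm_nonneg)
    then show ?thesis by (simp add: bnorm_power2 power_mult_distrib)
  qed
  have xz: "ip M x z = t *\<^sub>R (ip M x y * star (ip M x y))"
    "ip M z x = t *\<^sub>R (ip M x y * star (ip M x y))"
    using x y by (simp_all add: z_def ip_simps star_scaleR star_yx star_ip)
  define p where "p = ip M x z"
  have p: "ip M x z = p" "ip M z x = p" by (simp_all add: p_def xz)
  have "4 *\<^sub>R p = (p + p) + (p + p)"
    by (simp flip: scaleR_2)
  then have "4 *\<^sub>R ip M x z = ip M (madd M x z) (madd M x z) - ip M (mminus M x z) (mminus M x z)"
    using x z by (simp add: ip_simps closed_rules p)
  then have "4 * norm (ip M x z)
      = norm (ip M (madd M x z) (madd M x z) - ip M (mminus M x z) (mminus M x z))"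
    by (metis norm_scaleR abs_numeral)
  also have "\<dots> \<le> norm (ip M (madd M x z) (madd M x z)) + norm (ip M (mminus M x z) (mminus M x z))"
    by (rule norm_triangle_ineq4)
  also have "\<dots> \<le> 4 * (bnorm M x)\<^sup>2 + 4 * (bnorm M x)\<^sup>2"
    using x z by (intro add_mono le bnorm_triangle bnorm_minus_triangle_le)
  finally have "4 * norm (ip M x z) \<le> 4 * (bnorm M x)\<^sup>2 + 4 * (bnorm M x)\<^sup>2" .
  moreover have "norm (ip M x z) = t * n\<^sup>2"
    using cstar_identity[of "star (ip M x y)"] t by (simp add: xz star_star norm_star n_def)
  ultimately have "t * n\<^sup>2 \<le> 2 * (bnorm M x)\<^sup>2" by simp
  moreover have "t * n\<^sup>2 = bnorm M x * n / bnorm M y"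
    using pos by (simp add: t_def power2_eq_square)
  ultimately have "bnorm M x * n \<le> bnorm M x * (2 * bnorm M x * bnorm M y)"
    using pos by (simp add: divide_le_eq power2_eq_square mult_ac)
  then show ?thesis using pos by (simp add: n_def)
qed

end

context hilbert_bimodule
begin

lemma lmul_star: "\<lbrakk>x \<in> carrier M; y \<in> carrier M\<rbrakk> \<Longrightarrow> ip M (lmul M b x) y = ip M x (lmul M (star b) y)"
  using lmul_adjoint[of x y "star b"] by (simp add: star_star)

lemma lmul_scaleR: "x \<in> carrier M \<Longrightarrow> lmul M (r *\<^sub>R b) x = rmul M (lmul M b x) (r *\<^sub>R 1)"
  using lmul_scaleC[of x "complex_of_real r" b] by (simp add: scaleC_of_real mscale_def)

lemma lmul_mscale: "x \<in> carrier M \<Longrightarrow> lmul M b (mscale M c x) = mscale M c (lmul M b x)"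
  by (simp add: mscale_def lmul_rmul)

lemma bnorm_lmul_unitary:
  assumes "x \<in> carrier M" "star u * u = 1"
  shows "bnorm M (lmul M u x) = bnorm M x"
  using assms lmul_mult[of x "star u" u]
  by (simp add: bnorm_def lmul_star lmul_closed lmul_one)

text \<open>For \<open>k\<close> selfadjoint with norm at most \<open>1/2\<close>, choose \<open>a\<close> selfadjoint commuting with \<open>k\<close> such that
  \<open>k\<^sup>2 + a\<^sup>2 = 1\<close>. Then \<open>u = k + \<i> a\<close> and \<open>v = u\<^sup>* = k - \<i> a\<close> are unitary, and \<open>k = (u + v) / 2\<close>. The
  general case follows by scaling, which costs the factor \<open>2\<close>.\<close>

lemma bnorm_lmul_selfadjoint_le:
  assumes x: "x \<in> carrier M" and sa: "star h = h"
  shows "bnorm M (lmul M h x) \<le> 2 * norm h * bnorm M x"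
proof -
  have small: "bnorm M (lmul M k x) \<le> bnorm M x" if k: "star k = k" "norm k \<le> 1/2" for k
  proof -
    obtain a where a: "star a = a" "k * a = a * k" "a * a = 1 - k * k"
      using sqrt_one_minus_square_exists[OF k] by blast
    define u where "u = k + scaleC \<i> a"
    define v where "v = k - scaleC \<i> a"
    have minus_i: "scaleC (- \<i>) a = - scaleC \<i> a"
      using scaleC_scaleC[of "- 1" \<i> a] by (simp add: scaleC_minus_one)
    have sq: "scaleC \<i> a * scaleC \<i> a = k * k - 1"
      by (simp add: mult_scaleC_left mult_scaleC_right scaleC_scaleC scaleC_minus_one a)
    have comm: "k * scaleC \<i> a = scaleC \<i> a * k"
      by (simp add: mult_scaleC_left mult_scaleC_right a)
    have star_u: "star u = v" and star_v: "star v = u"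
      by (simp_all add: u_def v_def star_add star_diff star_scaleC k a minus_i)
    have "v * u = 1" "u * v = 1"
      by (simp_all add: u_def v_def algebra_simps comm sq)
    then have uv: "bnorm M (lmul M u x) = bnorm M x" "bnorm M (lmul M v x) = bnorm M x"
      using x by (simp_all add: bnorm_lmul_unitary star_u star_v)
    have "k = (1/2) *\<^sub>R (u + v)"
      by (simp add: u_def v_def scaleR_2[symmetric])
    then have "lmul M k x = lmul M ((1/2) *\<^sub>R (u + v)) x" by (rule arg_cong)
    also have "\<dots> = rmul M (madd M (lmul M u x) (lmul M v x)) ((1/2) *\<^sub>R 1)"
      by (subst lmul_scaleR[OF x], subst lmul_add_left[OF x]) (rule refl)
    finally have eq: "lmul M k x = rmul M (madd M (lmul M u x) (lmul M v x)) ((1/2) *\<^sub>R 1)" .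
    have "bnorm M (lmul M k x) \<le> bnorm M (madd M (lmul M u x) (lmul M v x)) * (1/2)"
      unfolding eq
      using bnorm_rmul_le[of "madd M (lmul M u x) (lmul M v x)" "(1/2) *\<^sub>R 1"] x
      by (simp add: closed_rules lmul_closed)
    also have "\<dots> \<le> bnorm M x"
      using bnorm_triangle[of "lmul M u x" "lmul M v x"] x by (simp add: lmul_closed uv)
    finally show ?thesis .
  qed
  show ?thesis
  proof (cases "h = 0")
    case True
    have "lmul M 0 x = mzero M"
      using lmul_scaleR[OF x, of 0 0] x by (simp add: rmul_zero lmul_closed)
    moreover have "bnorm M (mzero M) = 0" by (simp add: bnorm_eq_0 zero_closed)
    ultimately show ?thesis using True by simp
  next
    case False
    define r where "r = 2 * norm h"
    have r: "r > 0" using False by (simp add: r_def)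
    define k where "k = (1/r) *\<^sub>R h"
    have "h = r *\<^sub>R k" using r by (simp add: k_def)
    then have "bnorm M (lmul M h x) \<le> bnorm M (lmul M k x) * r"
      using bnorm_rmul_le[of "lmul M k x" "r *\<^sub>R 1"] r x by (simp add: lmul_scaleR lmul_closed)
    also have "\<dots> \<le> bnorm M x * r"
      using r False by (intro mult_right_mono small) (simp_all add: k_def star_scaleR sa r_def)
    finally show ?thesis by (simp add: r_def mult_ac)
  qed
qed

text \<open>The square of the norm of \<open>b x\<close> is the norm of \<open>\<langle>x, b\<^sup>* b x\<rangle>\<close>, which reduces the claim to the
  selfadjoint element \<open>b\<^sup>* b\<close>.\<close>

lemma bnorm_lmul_le:
  assumes x: "x \<in> carrier M"
  shows "bnorm M (lmul M b x) \<le> 2 * norm b * bnorm M x"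
proof (rule power2_le_imp_le)
  have "(bnorm M (lmul M b x))\<^sup>2 = norm (ip M x (lmul M (star b * b) x))"
    using x by (simp add: bnorm_power2 lmul_star lmul_closed lmul_mult)
  also have "\<dots> \<le> 2 * bnorm M x * bnorm M (lmul M (star b * b) x)"
    using x by (intro Cauchy_Schwarz lmul_closed)
  also have "\<dots> \<le> 2 * bnorm M x * (2 * norm (star b * b) * bnorm M x)"
    using x by (intro mult_left_mono bnorm_lmul_selfadjoint_le)
      (simp_all add: star_mult star_star bnorm_nonneg)
  also have "\<dots> = (2 * norm b * bnorm M x)\<^sup>2"
    by (simp add: cstar_identity power2_eq_square mult_ac)
  finally show "(bnorm M (lmul M b x))\<^sup>2 \<le> (2 * norm b * bnorm M x)\<^sup>2" .
qed (simp add: bnorm_nonneg)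

lemma norm_ip_lmul_le:
  assumes "x \<in> carrier M" "y \<in> carrier M"
  shows "norm (ip M x (lmul M b y)) \<le> 4 * bnorm M x * bnorm M y * norm b"
proof -
  have "norm (ip M x (lmul M b y)) \<le> 2 * bnorm M x * bnorm M (lmul M b y)"
    using assms by (intro Cauchy_Schwarz lmul_closed)
  also have "\<dots> \<le> 2 * bnorm M x * (2 * norm b * bnorm M y)"
    using assms by (intro mult_left_mono bnorm_lmul_le) (simp_all add: bnorm_nonneg)
  finally show ?thesis by (simp add: mult_ac)
qed

end

section \<open>Continuity of semigroups and of pairs of units\<close>

text \<open>The semigroup law gives \<open>T\<^sub>t - T\<^sub>s = T\<^sub>s (T\<^sub>t\<^sub>-\<^sub>s - id)\<close> for \<open>s \<le> t\<close>. With local bounds \<open>g\<close> and a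
  modulus of continuity \<open>e\<close> at \<open>0\<close> this yields
  \<open>\<parallel>T\<^sub>t - T\<^sub>s\<parallel> \<le> g (min s t) e \<bar>t - s\<bar>\<close> without ordering \<open>s\<close> and \<open>t\<close>, so left and right continuity are
  obtained at once.\<close>

lemma uniformly_continuous_semigroupI:
  fixes T :: "real \<Rightarrow> 'b \<Rightarrow> 'b::real_normed_vector" and g e :: "real \<Rightarrow> real"
  assumes linear: "\<And>t. 0 \<le> t \<Longrightarrow> bounded_linear (T t)"
    and zero: "T 0 = id"
    and add: "\<And>s t. \<lbrakk>0 \<le> s; 0 \<le> t\<rbrakk> \<Longrightarrow> T (s + t) = T s \<circ> T t"
    and bound: "\<And>t b. 0 \<le> t \<Longrightarrow> norm (T t b) \<le> g t * norm b"
    and near: "\<And>t b. 0 \<le> t \<Longrightarrow> norm (T t b - b) \<le> e t * norm b"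
    and g: "continuous_on {0..} g" "\<And>t. 0 \<le> g t"
    and e: "continuous_on {0..} e" "e 0 = 0" "\<And>t. 0 \<le> e t"
  shows "uniformly_continuous_semigroup T"
proof -
  have increment: "norm (Blinfun (T t) - Blinfun (T s)) \<le> g s * e (t - s)"
    if st: "0 \<le> s" "s \<le> t" for s t
  proof (rule norm_blinfun_bound)
    fix b
    interpret Ts: bounded_linear "T s" by (rule linear) (rule st)
    have "T t b = T s (T (t - s) b)"
      using add[of s "t - s"] st by simp
    then have "norm (T t b - T s b) = norm (T s (T (t - s) b - b))"
      by (simp add: Ts.diff)
    also have "\<dots> \<le> g s * (e (t - s) * norm b)"
      using st by (intro order_trans[OF bound] mult_left_mono near g) auto
    finally show "norm (blinfun_apply (Blinfun (T t) - Blinfun (T s)) b) \<le> g s * e (t - s) * norm b"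
      using st by (simp add: blinfun.diff_left bounded_linear_Blinfun_apply linear mult.assoc)
  qed (simp add: g e)
  have both: "dist (Blinfun (T t)) (Blinfun (T s)) \<le> g (min s t) * e \<bar>t - s\<bar>"
    if "0 \<le> s" "0 \<le> t" for s t
    using increment[of s t] increment[of t s] that
    by (cases "s \<le> t") (auto simp: dist_norm min_def norm_minus_commute abs_if)
  have "continuous_on {0..} (\<lambda>t. Blinfun (T t))"
    unfolding continuous_on_def
  proof
    fix s :: real assume "s \<in> {0..}"
    then have s: "0 \<le> s" by simp
    have cont: "continuous_on {0..} (\<lambda>t. g (min s t) * e \<bar>t - s\<bar>)"
      using s by (intro continuous_intros continuous_on_compose2[OF g(1)]
          continuous_on_compose2[OF e(1)]) auto
    have "((\<lambda>t. g (min s t) * e \<bar>t - s\<bar>) \<longlongrightarrow> 0) (at s within {0..})"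
      using cont[unfolded continuous_on_def, THEN bspec, OF \<open>s \<in> {0..}\<close>] by (simp add: e(2))
    moreover have "\<forall>\<^sub>F t in at s within {0..}.
        norm (dist (Blinfun (T t)) (Blinfun (T s))) \<le> g (min s t) * e \<bar>t - s\<bar>"
      using s both by (auto simp: eventually_at_filter)
    ultimately have "((\<lambda>t. dist (Blinfun (T t)) (Blinfun (T s))) \<longlongrightarrow> 0) (at s within {0..})"
      by (rule Lim_null_comparison[rotated])
    then show "((\<lambda>t. Blinfun (T t)) \<longlongrightarrow> Blinfun (T s)) (at s within {0..})"
      by (rule tendsto_dist_iff[THEN iffD2])
  qed
  then show ?thesis
    using assms unfolding uniformly_continuous_semigroup_def by blast
qed

lemma unit_in_carrier: "\<lbrakk>\<xi> \<in> units P; 0 \<le> t\<rbrakk> \<Longrightarrow> \<xi> t \<in> carrier (fibre P t)"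
  by (auto simp: units_def)

lemma unit_zero: "\<xi> \<in> units P \<Longrightarrow> \<xi> 0 = unit0 P 1"
  by (simp add: units_def)

lemma unit_tens: "\<lbrakk>\<xi> \<in> units P; 0 \<le> s; 0 \<le> t\<rbrakk> \<Longrightarrow> tens P s t (\<xi> s) (\<xi> t) = \<xi> (s + t)"
  by (simp add: units_def)

lemma bounded_linear_unit_semigroup:
  assumes "hilbert_bimodule (fibre P t)"
    and \<xi>: "\<xi> t \<in> carrier (fibre P t)" and \<xi>': "\<xi>' t \<in> carrier (fibre P t)"
  shows "bounded_linear (unit_semigroup P \<xi> \<xi>' t)"
proof -
  interpret hilbert_bimodule "fibre P t" by fact
  show ?thesis
  proof (rule bounded_linear_intro)
    fix b c :: 'a and r :: real
    show "unit_semigroup P \<xi> \<xi>' t (b + c) = unit_semigroup P \<xi> \<xi>' t b + unit_semigroup P \<xi> \<xi>' t c"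
      using \<xi> \<xi>' by (simp add: unit_semigroup_def lmul_add_left ip_add_right lmul_closed)
    show "unit_semigroup P \<xi> \<xi>' t (r *\<^sub>R b) = r *\<^sub>R unit_semigroup P \<xi> \<xi>' t b"
      using \<xi> \<xi>' by (simp add: unit_semigroup_def lmul_scaleR ip_rmul_right lmul_closed)
    show "norm (unit_semigroup P \<xi> \<xi>' t b)
        \<le> norm b * (4 * bnorm (fibre P t) (\<xi> t) * bnorm (fibre P t) (\<xi>' t))"
      using norm_ip_lmul_le[OF \<xi> \<xi>', of b] by (simp add: unit_semigroup_def mult_ac)
  qed
qed

context product_system
begin

lemma fibre_hilbert_module: "0 \<le> t \<Longrightarrow> hilbert_module (fibre P t)"
  using fibres by (simp add: hilbert_bimodule_def)

lemma unit0_closed: "unit0 P b \<in> carrier (fibre P 0)"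
  using fibre_zero by (auto simp: two_sided_unitary_def algebra_bimodule_def bij_betw_def)

lemma lmul_unit0: "lmul (fibre P 0) b (unit0 P c) = unit0 P (b * c)"
  using fibre_zero by (simp add: two_sided_unitary_def algebra_bimodule_def)

lemma rmul_unit0: "rmul (fibre P 0) (unit0 P c) b = unit0 P (c * b)"
  using fibre_zero
  by (simp add: two_sided_unitary_def algebra_bimodule_def) metis

lemma ip_unit0: "ip (fibre P 0) (unit0 P b) (unit0 P c) = star b * c"
  using fibre_zero by (simp add: two_sided_unitary_def algebra_bimodule_def)

lemma ip_tens:
  assumes "0 \<le> s" "0 \<le> t" "x \<in> carrier (fibre P s)" "y \<in> carrier (fibre P t)"
    "x' \<in> carrier (fibre P s)" "y' \<in> carrier (fibre P t)"
  shows "ip (fibre P (s + t)) (tens P s t x y) (tens P s t x' y')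
    = ip (fibre P t) y (lmul (fibre P t) (ip (fibre P s) x x') y')"
  using tensor[of s t] assms by (simp add: interior_tensor_def)

lemma lmul_tens:
  assumes "0 \<le> s" "0 \<le> t" "x \<in> carrier (fibre P s)" "y \<in> carrier (fibre P t)"
  shows "lmul (fibre P (s + t)) b (tens P s t x y) = tens P s t (lmul (fibre P s) b x) y"
  using tensor[of s t] assms by (simp add: interior_tensor_def)

lemma tens_closed:
  assumes "0 \<le> s" "0 \<le> t" "x \<in> carrier (fibre P s)" "y \<in> carrier (fibre P t)"
  shows "tens P s t x y \<in> carrier (fibre P (s + t))"
  using tensor[of s t] assms by (simp add: interior_tensor_def)

lemma unit_semigroup_zero:
  assumes "\<xi> \<in> units P" "\<xi>' \<in> units P"
  shows "unit_semigroup P \<xi> \<xi>' 0 = id"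
  using assms by (intro ext) (simp add: unit_semigroup_def unit_zero lmul_unit0 ip_unit0 star_one)

text \<open>The inner product formula for \<open>\<xi>\<^sub>t \<odot> \<xi>\<^sub>s\<close> applies the first factor's map first; commutativity of
  addition on the index then yields the composition in either order.\<close>

lemma unit_semigroup_add:
  assumes \<xi>: "\<xi> \<in> units P" and \<xi>': "\<xi>' \<in> units P" and st: "0 \<le> s" "0 \<le> t"
  shows "unit_semigroup P \<xi> \<xi>' (s + t) = unit_semigroup P \<xi> \<xi>' s \<circ> unit_semigroup P \<xi> \<xi>' t"
proof
  fix b
  interpret s: hilbert_bimodule "fibre P s" by (rule fibres) (rule st)
  interpret t: hilbert_bimodule "fibre P t" by (rule fibres) (rule st)
  have "unit_semigroup P \<xi> \<xi>' (t + s) b =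
      ip (fibre P (t + s)) (tens P t s (\<xi> t) (\<xi> s))
        (tens P t s (lmul (fibre P t) b (\<xi>' t)) (\<xi>' s))"
    using assms by (simp add: unit_semigroup_def lmul_tens[symmetric] unit_in_carrier unit_tens)
  also have "\<dots> = unit_semigroup P \<xi> \<xi>' s (unit_semigroup P \<xi> \<xi>' t b)"
    using assms by (simp add: ip_tens unit_in_carrier t.lmul_closed unit_semigroup_def)
  finally show "unit_semigroup P \<xi> \<xi>' (s + t) b
      = (unit_semigroup P \<xi> \<xi>' s \<circ> unit_semigroup P \<xi> \<xi>' t) b"
    by (simp add: add.commute)
qed

end

lemma continuous_on_orbit:
  assumes "uniformly_continuous_semigroup T"
  shows "continuous_on {0..} (\<lambda>t. T t b)"
proof -
  have "continuous_on {0..} (\<lambda>t. blinfun_apply (Blinfun (T t)) b)"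
    using assms by (intro continuous_intros) (simp add: uniformly_continuous_semigroup_def)
  moreover have "blinfun_apply (Blinfun (T t)) b = T t b" if "t \<in> {0..}" for t
    using assms that by (simp add: uniformly_continuous_semigroup_def bounded_linear_Blinfun_apply)
  ultimately show ?thesis by (rule continuous_on_eq)
qed

lemma continuous_set_subset:
  assumes "S \<subseteq> units P" "\<omega> \<in> S" "continuous_units P S"
  shows "S \<subseteq> units_continuous_with P \<omega>"
  using assms by (auto simp: units_continuous_with_def continuous_units_def)

context
  fixes P :: "('b::unital_cstar_algebra, 'e) product_system_data" and \<omega> :: "real \<Rightarrow> 'e"
  assumes spatial: "spatial_product_system P \<omega>"
begin

interpretation product_system P
  using spatial by (simp add: spatial_product_system_def)

lemma reference_unit: "\<omega> \<in> units P"
  using spatial by (simp add: spatial_product_system_def)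

lemma unit_semigroup_reference: "0 \<le> t \<Longrightarrow> unit_semigroup P \<omega> \<omega> t b = b"
  using spatial fibre_hilbert_module[of t] unit_in_carrier[OF reference_unit, of t]
  by (simp add: spatial_product_system_def unit_semigroup_def unital_unit_def central_unit_def
      hilbert_module.ip_rmul_right)

lemma reference_unit_continuous: "\<omega> \<in> units_continuous_with P \<omega>"
proof -
  have "uniformly_continuous_semigroup (unit_semigroup P \<omega> \<omega>)"
    using reference_unit
    by (intro uniformly_continuous_semigroupI[where g = "\<lambda>_. 1" and e = "\<lambda>_. 0"])
      (auto simp: unit_semigroup_reference unit_semigroup_zero unit_semigroup_add unit_in_carrier
        fibres intro!: bounded_linear_unit_semigroup)
  then show ?thesis
    by (simp add: units_continuous_with_def continuous_units_def reference_unit)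
qed

text \<open>The square of this norm is the norm of the value at \<open>1\<close> of the semigroup of the pair \<open>(\<xi>, \<xi>)\<close>.\<close>

lemma continuous_bnorm_unit:
  assumes "\<xi> \<in> units_continuous_with P \<omega>"
  shows "continuous_on {0..} (\<lambda>t. bnorm (fibre P t) (\<xi> t))"
proof -
  have \<xi>: "\<xi> \<in> units P" and cont: "uniformly_continuous_semigroup (unit_semigroup P \<xi> \<xi>)"
    using assms by (auto simp: units_continuous_with_def continuous_units_def)
  have c: "continuous_on {0..} (\<lambda>t. sqrt (norm (unit_semigroup P \<xi> \<xi> t 1)))"
    by (intro continuous_intros continuous_on_orbit cont)
  have eq: "unit_semigroup P \<xi> \<xi> t 1 = ip (fibre P t) (\<xi> t) (\<xi> t)" if "t \<in> {0..}" for t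
    using fibres[of t] that \<xi>
    by (simp add: unit_semigroup_def hilbert_bimodule.lmul_one unit_in_carrier)
  show ?thesis
    by (rule continuous_on_eq[OF c]) (simp add: bnorm_def eq)
qed

text \<open>Expanding the square of the distance gives the values at \<open>1\<close> of the four semigroups of the pairs
  from \<open>{\<omega>, \<xi>}\<close>, which are continuous by assumption.\<close>

lemma continuous_distance_to_reference_unit:
  assumes "\<xi> \<in> units_continuous_with P \<omega>"
  shows "continuous_on {0..} (\<lambda>t. bnorm (fibre P t) (mminus (fibre P t) (\<xi> t) (\<omega> t)))"
proof -
  have \<xi>: "\<xi> \<in> units P" and cont:
    "uniformly_continuous_semigroup (unit_semigroup P \<xi> \<xi>)"
    "uniformly_continuous_semigroup (unit_semigroup P \<xi> \<omega>)"
    "uniformly_continuous_semigroup (unit_semigroup P \<omega> \<xi>)"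
    "uniformly_continuous_semigroup (unit_semigroup P \<omega> \<omega>)"
    using assms by (auto simp: units_continuous_with_def continuous_units_def)
  have c: "continuous_on {0..} (\<lambda>t. sqrt (norm
      (unit_semigroup P \<xi> \<xi> t 1 - unit_semigroup P \<xi> \<omega> t 1
        - (unit_semigroup P \<omega> \<xi> t 1 - unit_semigroup P \<omega> \<omega> t 1))))"
    by (intro continuous_intros continuous_on_orbit cont)
  have eq: "unit_semigroup P \<xi> \<xi> t 1 - unit_semigroup P \<xi> \<omega> t 1
        - (unit_semigroup P \<omega> \<xi> t 1 - unit_semigroup P \<omega> \<omega> t 1)
      = ip (fibre P t) (mminus (fibre P t) (\<xi> t) (\<omega> t)) (mminus (fibre P t) (\<xi> t) (\<omega> t))"
    if t: "t \<in> {0..}" for t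
  proof -
    interpret hilbert_bimodule "fibre P t" using t by (simp add: fibres)
    show ?thesis
      using t \<xi> reference_unit
      by (simp add: unit_semigroup_def lmul_one ip_simps unit_in_carrier closed_rules)
  qed
  show ?thesis
    by (rule continuous_on_eq[OF c]) (simp add: bnorm_def eq)
qed

text \<open>Estimate the two terms of \<open>\<langle>\<xi>, b \<eta>\<rangle> - b = \<langle>\<xi> - \<omega>, b \<eta>\<rangle> + (\<langle>\<omega>, b \<eta>\<rangle> - b)\<close>, the reference unit serving
  as the intermediate point between \<open>\<xi>\<close> and \<open>\<eta>\<close>.\<close>

lemma norm_unit_semigroup_minus_id_le:
  assumes \<xi>: "\<xi> \<in> units P" and \<eta>: "\<eta> \<in> units P" and t: "0 \<le> t"
    and bl: "bounded_linear (unit_semigroup P \<omega> \<eta> t)"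
  shows "norm (unit_semigroup P \<xi> \<eta> t b - b) \<le>
    (4 * bnorm (fibre P t) (mminus (fibre P t) (\<xi> t) (\<omega> t)) * bnorm (fibre P t) (\<eta> t)
      + norm (Blinfun (unit_semigroup P \<omega> \<eta> t) - id_blinfun)) * norm b"
proof -
  interpret hilbert_bimodule "fibre P t" by (rule fibres) (rule t)
  note in_carrier = \<xi>[THEN unit_in_carrier, OF t] \<eta>[THEN unit_in_carrier, OF t]
    reference_unit[THEN unit_in_carrier, OF t]
  have "unit_semigroup P \<xi> \<eta> t b - b =
      ip (fibre P t) (mminus (fibre P t) (\<xi> t) (\<omega> t)) (lmul (fibre P t) b (\<eta> t))
        + blinfun_apply (Blinfun (unit_semigroup P \<omega> \<eta> t) - id_blinfun) b"
    using in_carrier bl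
    by (simp add: unit_semigroup_def ip_simps lmul_closed blinfun.diff_left
        bounded_linear_Blinfun_apply[OF bl])
  then show ?thesis
    using norm_ip_lmul_le[of "mminus (fibre P t) (\<xi> t) (\<omega> t)" "\<eta> t" b] in_carrier
      norm_blinfun[of "Blinfun (unit_semigroup P \<omega> \<eta> t) - id_blinfun" b]
    by (simp add: closed_rules distrib_right norm_triangle_le add_mono)
qed

text \<open>Transitivity of continuity through the reference unit: for small times \<open>\<xi>\<^sub>t\<close> is close to \<open>\<omega>\<^sub>t\<close> in
  norm and the semigroup of \<open>(\<omega>, \<eta>)\<close> is close to the identity, hence so is the semigroup of
  \<open>(\<xi>, \<eta>)\<close>; the norms of \<open>\<xi>\<^sub>t\<close> and \<open>\<eta>\<^sub>t\<close>, which are continuous in \<open>t\<close>, bound it locally.\<close>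

lemma continuous_units_continuous_with_reference:
  "continuous_units P (units_continuous_with P \<omega>)"
  unfolding continuous_units_def
proof (intro ballI)
  fix \<xi> \<eta> assume \<xi>: "\<xi> \<in> units_continuous_with P \<omega>" and \<eta>: "\<eta> \<in> units_continuous_with P \<omega>"
  then have \<xi>u: "\<xi> \<in> units P" and \<eta>u: "\<eta> \<in> units P"
    and cont: "uniformly_continuous_semigroup (unit_semigroup P \<omega> \<eta>)"
    by (auto simp: units_continuous_with_def continuous_units_def)
  let ?d = "\<lambda>t. bnorm (fibre P t) (mminus (fibre P t) (\<xi> t) (\<omega> t))"
  let ?n = "\<lambda>\<zeta> t. bnorm (fibre P t) (\<zeta> t)"
  let ?e = "\<lambda>t. 4 * ?d t * ?n \<eta> t + norm (Blinfun (unit_semigroup P \<omega> \<eta> t) - id_blinfun)"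
  interpret zero: hilbert_module "fibre P 0" by (simp add: fibre_hilbert_module)
  have nonneg: "0 \<le> bnorm (fibre P t) x" for t x
    by (simp add: bnorm_def)
  have "?d 0 = 0"
    using \<xi>u reference_unit unit0_closed[of 1]
    by (simp add: unit_zero bnorm_def zero.ip_simps zero.closed_rules)
  moreover have "Blinfun (unit_semigroup P \<omega> \<eta> 0) = id_blinfun"
    using \<eta>u reference_unit by (simp add: unit_semigroup_zero id_blinfun.abs_eq id_def)
  ultimately have e0: "?e 0 = 0" by simp
  show "uniformly_continuous_semigroup (unit_semigroup P \<xi> \<eta>)"
  proof (rule uniformly_continuous_semigroupI[where g = "\<lambda>t. 4 * ?n \<xi> t * ?n \<eta> t" and e = ?e])
    fix t :: real and b :: 'b assume t: "0 \<le> t"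
    show "bounded_linear (unit_semigroup P \<xi> \<eta> t)"
      using \<xi>u \<eta>u t by (intro bounded_linear_unit_semigroup fibres unit_in_carrier)
    show "norm (unit_semigroup P \<xi> \<eta> t b) \<le> 4 * ?n \<xi> t * ?n \<eta> t * norm b"
      unfolding unit_semigroup_def
      using \<xi>u \<eta>u t by (intro hilbert_bimodule.norm_ip_lmul_le fibres unit_in_carrier)
    show "norm (unit_semigroup P \<xi> \<eta> t b - b) \<le> ?e t * norm b"
      using \<xi>u \<eta>u t cont
      by (intro norm_unit_semigroup_minus_id_le) (auto simp: uniformly_continuous_semigroup_def)
  next
    show "continuous_on {0..} (\<lambda>t. 4 * ?n \<xi> t * ?n \<eta> t)"
      using \<xi> \<eta> by (intro continuous_intros continuous_bnorm_unit)
    show "continuous_on {0..} ?e"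
      using \<xi> \<eta> cont
      by (intro continuous_intros continuous_bnorm_unit continuous_distance_to_reference_unit)
        (simp_all add: uniformly_continuous_semigroup_def)
  qed (use \<xi>u \<eta>u e0 in \<open>simp_all add: unit_semigroup_zero unit_semigroup_add nonneg\<close>)
qed

end

section \<open>Closed spans and submodules\<close>

abbreviation closed_span ::
  "('b::unital_cstar_algebra, 'e) bimodule_data \<Rightarrow> 'e set \<Rightarrow> 'e set"
  where "closed_span M A \<equiv> mclosure M (mspan M A)"

lemma mspan_mono: "A \<subseteq> B \<Longrightarrow> mspan M A \<subseteq> mspan M B"
proof
  fix x assume "A \<subseteq> B" "x \<in> mspan M A"
  from this(2) show "x \<in> mspan M B"
    by induction (use \<open>A \<subseteq> B\<close> in \<open>auto intro: mspan.intros\<close>)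
qed

context hilbert_module
begin

lemma mclosure_iff:
  "x \<in> mclosure M A \<longleftrightarrow>
    x \<in> carrier M \<and> (\<forall>r>0. \<exists>y\<in>A. y \<in> carrier M \<and> bnorm M (mminus M x y) < r)"
  by (auto simp: mclosure_def Metric_space.metric_closure_of[OF metric]
      Metric_space.in_mball[OF metric] bdist_def)

lemma mclosure_subset_carrier: "mclosure M A \<subseteq> carrier M"
  by (auto simp: mclosure_iff)

lemma mclosure_mono: "A \<subseteq> B \<Longrightarrow> mclosure M A \<subseteq> mclosure M B"
  unfolding mclosure_def by (rule closure_of_mono)

lemma subset_mclosure: "A \<subseteq> carrier M \<Longrightarrow> A \<subseteq> mclosure M A"
  unfolding mclosure_def
  by (rule closure_of_subset) (simp add: Metric_space.topspace_mtopology[OF metric])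

lemma mclosure_mclosure: "mclosure M (mclosure M A) = mclosure M A"
  by (simp add: mclosure_def closure_of_closure_of)

lemma mspan_subset_carrier:
  assumes "A \<subseteq> carrier M"
  shows "mspan M A \<subseteq> carrier M"
proof
  fix x assume "x \<in> mspan M A"
  then show "x \<in> carrier M"
    by induction (use assms in \<open>auto simp: closed_rules\<close>)
qed

lemma closed_span_base: "\<lbrakk>A \<subseteq> carrier M; x \<in> A\<rbrakk> \<Longrightarrow> x \<in> closed_span M A"
  by (rule subsetD[OF subset_mclosure[OF mspan_subset_carrier]]) (auto intro: mspan.base)

lemma closed_span_zero: "A \<subseteq> carrier M \<Longrightarrow> mzero M \<in> closed_span M A"
  by (rule subsetD[OF subset_mclosure[OF mspan_subset_carrier]]) (auto intro: mspan.zero)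

lemma closed_span_mscale:
  assumes "x \<in> closed_span M A"
  shows "mscale M c x \<in> closed_span M A"
proof -
  have x: "x \<in> carrier M" using assms by (simp add: mclosure_iff)
  have "\<exists>y\<in>mspan M A. y \<in> carrier M \<and> bnorm M (mminus M (mscale M c x) y) < r" if r: "r > 0" for r
  proof -
    have "r / (cmod c + 1) > 0" using r by (simp add: add_nonneg_pos)
    then obtain y where y: "y \<in> mspan M A" "y \<in> carrier M"
      and near: "bnorm M (mminus M x y) < r / (cmod c + 1)"
      using assms unfolding mclosure_iff by blast
    have "mminus M (mscale M c x) (mscale M c y) = mscale M c (mminus M x y)"
      using x y by (intro eq_by_ip)
        (simp_all add: mscale_def ip_simps closed_rules algebra_simps)
    then have "bnorm M (mminus M (mscale M c x) (mscale M c y)) \<le> cmod c * bnorm M (mminus M x y)"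
      using x y by (simp add: bnorm_mscale_le closed_rules)
    also have "\<dots> \<le> (cmod c + 1) * bnorm M (mminus M x y)"
      by (simp add: mult_right_mono bnorm_nonneg)
    also have "\<dots> < r"
      using near by (simp add: less_divide_eq add_nonneg_pos mult.commute)
    finally show ?thesis
      using mspan.scale[OF y(1)] mscale_closed[OF y(2)] by blast
  qed
  then show ?thesis using x by (simp add: mclosure_iff closed_rules)
qed

lemma closed_span_madd:
  assumes x: "x \<in> closed_span M A" and y: "y \<in> closed_span M A"
  shows "madd M x y \<in> closed_span M A"
proof -
  have xy: "x \<in> carrier M" "y \<in> carrier M" using assms by (simp_all add: mclosure_iff)
  have "\<exists>z\<in>mspan M A. z \<in> carrier M \<and> bnorm M (mminus M (madd M x y) z) < r" if r: "r > 0" for r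
  proof -
    obtain a where a: "a \<in> mspan M A" "a \<in> carrier M" "bnorm M (mminus M x a) < r / 2"
      using x r unfolding mclosure_iff by (meson half_gt_zero)
    obtain b where b: "b \<in> mspan M A" "b \<in> carrier M" "bnorm M (mminus M y b) < r / 2"
      using y r unfolding mclosure_iff by (meson half_gt_zero)
    have "mminus M (madd M x y) (madd M a b) = madd M (mminus M x a) (mminus M y b)"
      using xy a b by (intro eq_by_ip) (simp_all add: ip_simps closed_rules algebra_simps)
    then have "bnorm M (mminus M (madd M x y) (madd M a b)) < r"
      using bnorm_triangle[of "mminus M x a" "mminus M y b"] xy a b by (simp add: closed_rules)
    then show ?thesis
      using mspan.add[OF a(1) b(1)] add_closed[OF a(2) b(2)] by blast
  qed
  then show ?thesis using xy by (simp add: mclosure_iff closed_rules)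
qed

end

text \<open>The image of a limit of linear combinations is a limit of points of the closed span of \<open>B\<close>,
  because \<open>f\<close> is bounded. Both module actions and the tensor product with a fixed vector are maps
  \<open>f\<close> of this kind, which is how properties of words reach the closures.\<close>

lemma closed_span_image:
  fixes M :: "('b::unital_cstar_algebra, 'm) bimodule_data"
    and N :: "('b, 'n) bimodule_data"
  assumes "hilbert_module M" "hilbert_module N"
    and A: "A \<subseteq> carrier M" and B: "B \<subseteq> carrier N"
    and closed: "\<And>x. x \<in> carrier M \<Longrightarrow> f x \<in> carrier N"
    and add: "\<And>x y. \<lbrakk>x \<in> carrier M; y \<in> carrier M\<rbrakk> \<Longrightarrow> f (madd M x y) = madd N (f x) (f y)"
    and scale: "\<And>x c. x \<in> carrier M \<Longrightarrow> f (mscale M c x) = mscale N c (f x)"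
    and bound: "\<And>x. x \<in> carrier M \<Longrightarrow> bnorm N (f x) \<le> K * bnorm M x" and K: "0 \<le> K"
    and base: "\<And>x. x \<in> A \<Longrightarrow> f x \<in> closed_span N B"
    and x: "x \<in> closed_span M A"
  shows "f x \<in> closed_span N B"
proof -
  interpret M: hilbert_module M by fact
  interpret N: hilbert_module N by fact
  have zero: "f (mzero M) = mzero N"
    using scale[of "mzero M" 0] closed[OF M.zero_closed] scaleC_of_real[of 0 "1::'b"]
    by (simp add: mscale_def M.rmul_zero N.rmul_zero M.zero_closed)
  have span: "f y \<in> closed_span N B" if "y \<in> mspan M A" for y
    using that
  proof induction
    case (add y z)
    then have "y \<in> carrier M" "z \<in> carrier M"
      using M.mspan_subset_carrier[OF A] by blast+
    then show ?case
      by (simp add: assms(6) N.closed_span_madd add.IH)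
  next
    case (scale y c)
    then have "y \<in> carrier M"
      using M.mspan_subset_carrier[OF A] by blast
    then show ?case
      by (simp add: assms(7) N.closed_span_mscale scale.IH)
  qed (simp_all add: zero N.closed_span_zero B base)
  have xM: "x \<in> carrier M" using x by (simp add: M.mclosure_iff)
  have "\<exists>z\<in>closed_span N B. z \<in> carrier N \<and> bnorm N (mminus N (f x) z) < r" if r: "r > 0" for r
  proof -
    have "r / (K + 1) > 0" using r K by simp
    then obtain y where y: "y \<in> mspan M A" "y \<in> carrier M"
      and near: "bnorm M (mminus M x y) < r / (K + 1)"
      using x unfolding M.mclosure_iff by blast
    have "mminus N (f x) (f y) = f (mminus M x y)"
      using xM y by (simp add: mminus_def add scale M.closed_rules)
    then have "bnorm N (mminus N (f x) (f y)) \<le> K * bnorm M (mminus M x y)"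
      using xM y by (simp add: bound M.closed_rules)
    also have "\<dots> \<le> (K + 1) * bnorm M (mminus M x y)"
      by (simp add: mult_right_mono M.bnorm_nonneg)
    also have "\<dots> < r"
      using near K by (simp add: less_divide_eq mult.commute)
    finally show ?thesis
      using span[OF y(1)] closed[OF y(2)] by blast
  qed
  then have "f x \<in> mclosure N (closed_span N B)"
    using xM by (simp add: N.mclosure_iff[of _ "closed_span N B"] closed)
  then show ?thesis by (simp add: N.mclosure_mclosure)
qed

lemma submodule_on_simps:
  "mscale (submodule_on M V) = mscale M"
  "mminus (submodule_on M V) = mminus M"
  "bnorm (submodule_on M V) = bnorm M"
  by (simp_all add: fun_eq_iff mscale_def mminus_def bnorm_def)

lemma mspan_submodule_on: "mspan (submodule_on M V) A = mspan M A"
proof (intro equalityI subsetI)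
  show "x \<in> mspan M A" if "x \<in> mspan (submodule_on M V) A" for x
    using that by induction (auto simp: submodule_on_simps intro: mspan.intros)
  show "x \<in> mspan (submodule_on M V) A" if "x \<in> mspan M A" for x
    using that
  proof induction
    case zero
    show ?case using mspan.zero[of "submodule_on M V"] by simp
  next
    case (add x y)
    then show ?case using mspan.add[of x "submodule_on M V" A y] by simp
  next
    case (scale x c)
    then show ?case using mspan.scale[of x "submodule_on M V" A c] by (simp add: submodule_on_simps)
  qed (rule mspan.base)
qed

lemma mclosure_submodule_on:
  assumes "hilbert_module M" "hilbert_module (submodule_on M V)" "V \<subseteq> carrier M" "A \<subseteq> V"
  shows "mclosure (submodule_on M V) A = mclosure M A \<inter> V"
proof -
  have "(\<exists>y\<in>A. y \<in> V \<and> R y) \<longleftrightarrow> (\<exists>y\<in>A. y \<in> carrier M \<and> R y)" for R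
    using assms(3,4) by blast
  then show ?thesis
    using assms(3) unfolding set_eq_iff
    by (simp add: hilbert_module.mclosure_iff[OF assms(1)] hilbert_module.mclosure_iff[OF assms(2)]
        submodule_on_simps) blast
qed

text \<open>A closed subset of a complete space is complete. The two metrics agree on the submodule but
  have their default value \<open>0\<close> on different sets, so Cauchy sequences and limits are transferred
  by hand.\<close>

lemma (in hilbert_bimodule) submodule_on_hilbert_bimodule:
  assumes V: "V \<subseteq> carrier M" and zero: "mzero M \<in> V"
    and add: "\<And>x y. \<lbrakk>x \<in> V; y \<in> V\<rbrakk> \<Longrightarrow> madd M x y \<in> V"
    and rmul: "\<And>x b. x \<in> V \<Longrightarrow> rmul M x b \<in> V"
    and lmul: "\<And>x b. x \<in> V \<Longrightarrow> lmul M b x \<in> V"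
    and closed: "mclosure M V \<subseteq> V"
  shows "hilbert_bimodule (submodule_on M V)"
proof -
  let ?d = "bdist (submodule_on M V)"
  have d: "?d x y = (if x \<in> V \<and> y \<in> V then bdist M x y else 0)" for x y
    using V by (auto simp: bdist_def submodule_on_simps)
  interpret M: Metric_space "carrier M" "bdist M" by (rule metric)
  have metric': "Metric_space V ?d"
    using V by unfold_locales (auto simp: d M.commute subset_iff M.triangle)
  then interpret V: Metric_space V ?d .
  have "V.mcomplete"
    unfolding V.mcomplete_def
  proof (intro allI impI)
    fix \<sigma> assume \<sigma>: "V.MCauchy \<sigma>"
    then have inV: "\<sigma> n \<in> V" for n by (auto simp: V.MCauchy_def)
    then have "M.MCauchy \<sigma>" using \<sigma> V by (auto simp: M.MCauchy_def V.MCauchy_def d)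
    then obtain x where x: "limitin M.mtopology \<sigma> x sequentially"
      using complete by (auto simp: M.mcomplete_def)
    have "\<exists>y\<in>V. y \<in> carrier M \<and> bnorm M (mminus M x y) < r" if r: "r > 0" for r
    proof -
      obtain n where "\<sigma> n \<in> carrier M" "bdist M (\<sigma> n) x < r"
        using x r by (auto simp: M.limit_metric_sequentially)
      then show ?thesis
        using inV[of n] x M.commute[of x "\<sigma> n"]
        by (intro bexI[of _ "\<sigma> n"]) (auto simp: bdist_def M.limit_metric_sequentially)
    qed
    then have "x \<in> mclosure M V"
      using x by (simp add: mclosure_iff M.limit_metric_sequentially)
    then have "x \<in> V" using closed by blast
    then have "limitin V.mtopology \<sigma> x sequentially"
      using x by (simp add: M.limit_metric_sequentially V.limit_metric_sequentially d inV) blast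
    then show "\<exists>x. limitin V.mtopology \<sigma> x sequentially" ..
  qed
  note inM = subsetD[OF V]
  have inverse: "\<exists>y\<in>V. madd M x y = mzero M" if x: "x \<in> V" for x
  proof (rule bexI)
    show "mscale M (- 1) x \<in> V" using rmul[OF x] by (simp add: mscale_def)
    show "madd M x (mscale M (- 1) x) = mzero M"
      using add_mscale_minus_one[OF inM[OF x]] add_commute[OF inM[OF x] mscale_closed[OF inM[OF x]]]
      by simp
  qed
  show ?thesis
  proof (intro hilbert_bimodule.intro hilbert_module.intro hilbert_bimodule_axioms.intro)
    show "Metric_space (carrier (submodule_on M V)) ?d" by (simp add: metric')
    show "madd (submodule_on M V) x y = madd (submodule_on M V) y x"
      if "x \<in> carrier (submodule_on M V)" "y \<in> carrier (submodule_on M V)" for x y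
      using that by (simp add: add_commute[OF inM inM])
    show "Metric_space.mcomplete (carrier (submodule_on M V)) ?d" by (simp add: \<open>V.mcomplete\<close>)
  qed (simp_all add: submodule_on_simps zero add rmul lmul inverse
      add_assoc[OF inM inM inM] add_zero[OF inM] rmul_add_left[OF inM inM]
      rmul_add_right[OF inM] rmul_rmul[OF inM] rmul_one[OF inM] ip_add_right[OF inM inM inM]
      ip_rmul_right[OF inM inM] star_ip[OF inM inM] ip_positive[OF inM] ip_definite[OF inM]
      lmul_add_right[OF inM inM] lmul_rmul[OF inM] lmul_mult[OF inM] lmul_one[OF inM]
      lmul_add_left[OF inM] lmul_scaleC[OF inM] lmul_adjoint[OF inM inM])
qed

lemma (in hilbert_bimodule) closed_span_hilbert_bimodule:
  assumes A: "A \<subseteq> carrier M"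
    and lmul: "\<And>x b. x \<in> A \<Longrightarrow> lmul M b x \<in> A"
    and rmul: "\<And>x b. x \<in> A \<Longrightarrow> rmul M x b \<in> A"
  shows "hilbert_bimodule (submodule_on M (closed_span M A))"
proof (rule submodule_on_hilbert_bimodule)
  fix x b assume x: "x \<in> closed_span M A"
  show "lmul M b x \<in> closed_span M A"
    by (rule closed_span_image[OF hilbert_module_axioms hilbert_module_axioms A A, where K = "2 * norm b"])
      (use x in \<open>simp_all add: lmul_closed lmul_add_right lmul_mscale bnorm_lmul_le
        closed_span_base[OF A lmul]\<close>)
  show "rmul M x b \<in> closed_span M A"
    by (rule closed_span_image[OF hilbert_module_axioms hilbert_module_axioms A A, where K = "norm b"
          and f = "\<lambda>x. rmul M x b"])
      (use x bnorm_rmul_le[of _ b] in \<open>simp_all add: closed_rules rmul_add_left mscale_def rmul_rmul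
        mult_scaleC_left mult_scaleC_right closed_span_base[OF A rmul] mult.commute\<close>)
qed (simp_all add: mclosure_subset_carrier closed_span_zero[OF A] closed_span_madd mclosure_mclosure)

section \<open>Algebra and boundedness of the tensor product\<close>

context product_system
begin

text \<open>The laws of elementary tensors are consequences of the inner product formula: by definiteness it
  suffices to compare the inner products of the two sides of each equation.\<close>

lemma tens_rmul_right:
  assumes st: "0 \<le> s" "0 \<le> t" and x: "x \<in> carrier (fibre P s)" and y: "y \<in> carrier (fibre P t)"
  shows "tens P s t x (rmul (fibre P t) y b) = rmul (fibre P (s + t)) (tens P s t x y) b"
proof -
  interpret s: hilbert_bimodule "fibre P s" by (rule fibres) (rule st)
  interpret t: hilbert_bimodule "fibre P t" by (rule fibres) (rule st)
  interpret st: hilbert_bimodule "fibre P (s + t)" by (rule fibres) (simp add: st)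
  show ?thesis
    using assms by (intro st.eq_by_ip)
      (simp_all add: ip_tens tens_closed t.closed_rules st.closed_rules st.ip_simps t.ip_simps
        t.lmul_rmul t.lmul_closed mult.assoc)
qed

lemma tens_balanced:
  assumes st: "0 \<le> s" "0 \<le> t" and x: "x \<in> carrier (fibre P s)" and y: "y \<in> carrier (fibre P t)"
  shows "tens P s t (rmul (fibre P s) x b) y = tens P s t x (lmul (fibre P t) b y)"
proof -
  interpret s: hilbert_bimodule "fibre P s" by (rule fibres) (rule st)
  interpret t: hilbert_bimodule "fibre P t" by (rule fibres) (rule st)
  interpret st: hilbert_bimodule "fibre P (s + t)" by (rule fibres) (simp add: st)
  show ?thesis
    using assms by (intro st.eq_by_ip)
      (simp_all add: ip_tens tens_closed s.closed_rules s.ip_simps t.lmul_mult t.lmul_star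
        t.lmul_closed)
qed

lemma tens_add_left:
  assumes st: "0 \<le> s" "0 \<le> t" and x: "x \<in> carrier (fibre P s)" "x' \<in> carrier (fibre P s)"
    and y: "y \<in> carrier (fibre P t)"
  shows "tens P s t (madd (fibre P s) x x') y
    = madd (fibre P (s + t)) (tens P s t x y) (tens P s t x' y)"
proof -
  interpret s: hilbert_bimodule "fibre P s" by (rule fibres) (rule st)
  interpret t: hilbert_bimodule "fibre P t" by (rule fibres) (rule st)
  interpret st: hilbert_bimodule "fibre P (s + t)" by (rule fibres) (simp add: st)
  show ?thesis
    using assms by (intro st.eq_by_ip)
      (simp_all add: ip_tens tens_closed s.closed_rules st.closed_rules st.ip_simps s.ip_simps
        t.ip_simps t.lmul_add_left t.lmul_closed t.closed_rules)
qed

lemma tens_add_right: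
  assumes st: "0 \<le> s" "0 \<le> t" and x: "x \<in> carrier (fibre P s)"
    and y: "y \<in> carrier (fibre P t)" "y' \<in> carrier (fibre P t)"
  shows "tens P s t x (madd (fibre P t) y y')
    = madd (fibre P (s + t)) (tens P s t x y) (tens P s t x y')"
proof -
  interpret s: hilbert_bimodule "fibre P s" by (rule fibres) (rule st)
  interpret t: hilbert_bimodule "fibre P t" by (rule fibres) (rule st)
  interpret st: hilbert_bimodule "fibre P (s + t)" by (rule fibres) (simp add: st)
  show ?thesis
    using assms by (intro st.eq_by_ip)
      (simp_all add: ip_tens tens_closed t.closed_rules st.closed_rules st.ip_simps
        t.ip_simps t.lmul_add_right t.lmul_closed)
qed

lemma tens_mscale_right:
  assumes "0 \<le> s" "0 \<le> t" "x \<in> carrier (fibre P s)" "y \<in> carrier (fibre P t)"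
  shows "tens P s t x (mscale (fibre P t) c y) = mscale (fibre P (s + t)) c (tens P s t x y)"
  using assms by (simp add: mscale_def tens_rmul_right)

text \<open>A complex scalar, seen as an element of the algebra, moves through the tensor sign by balancedness
  and acts on the right-hand factor from either side alike.\<close>

lemma tens_mscale_left:
  assumes "0 \<le> s" "0 \<le> t" "x \<in> carrier (fibre P s)" "y \<in> carrier (fibre P t)"
  shows "tens P s t (mscale (fibre P s) c x) y = mscale (fibre P (s + t)) c (tens P s t x y)"
proof -
  interpret t: hilbert_bimodule "fibre P t" by (rule fibres) (rule assms)
  have "tens P s t (mscale (fibre P s) c x) y = tens P s t x (mscale (fibre P t) c y)"
    using assms t.lmul_scaleC[of y c 1] by (simp add: mscale_def[of "fibre P s"] tens_balanced t.lmul_one)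
  then show ?thesis using assms by (simp add: tens_mscale_right)
qed

text \<open>The norm of \<open>\<langle>y, \<langle>x, x\<rangle> y\<rangle>\<close> is controlled by boundedness of the left action, which is why the
  tensor product is jointly bounded; this is what lets products of words pass to the closures.\<close>

lemma bnorm_tens_le:
  assumes st: "0 \<le> s" "0 \<le> t" and x: "x \<in> carrier (fibre P s)" and y: "y \<in> carrier (fibre P t)"
  shows "bnorm (fibre P (s + t)) (tens P s t x y)
    \<le> 2 * bnorm (fibre P s) x * bnorm (fibre P t) y"
proof (rule power2_le_imp_le)
  interpret s: hilbert_bimodule "fibre P s" by (rule fibres) (rule st)
  interpret t: hilbert_bimodule "fibre P t" by (rule fibres) (rule st)
  interpret st: hilbert_bimodule "fibre P (s + t)" by (rule fibres) (simp add: st)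
  have "(bnorm (fibre P (s + t)) (tens P s t x y))\<^sup>2
      = norm (ip (fibre P t) y (lmul (fibre P t) (ip (fibre P s) x x) y))"
    using assms by (simp add: st.bnorm_power2 ip_tens)
  also have "\<dots> \<le> 4 * bnorm (fibre P t) y * bnorm (fibre P t) y * norm (ip (fibre P s) x x)"
    by (rule t.norm_ip_lmul_le[OF y y])
  also have "\<dots> = (2 * bnorm (fibre P s) x * bnorm (fibre P t) y)\<^sup>2"
    by (simp add: s.bnorm_power2[symmetric] power2_eq_square)
  finally show "(bnorm (fibre P (s + t)) (tens P s t x y))\<^sup>2
      \<le> (2 * bnorm (fibre P s) x * bnorm (fibre P t) y)\<^sup>2" .
  show "0 \<le> 2 * bnorm (fibre P s) x * bnorm (fibre P t) y"
    by (simp add: s.bnorm_nonneg t.bnorm_nonneg)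
qed

end

section \<open>Words in a set of units\<close>

definition words ::
  "('b::unital_cstar_algebra, 'e) product_system_data \<Rightarrow> (real \<Rightarrow> 'e) set \<Rightarrow> real \<Rightarrow> 'e set"
  where "words P S t = {word P w b\<^sub>0 |w b\<^sub>0.
    (\<forall>(b, \<xi>, r)\<in>set w. \<xi> \<in> S \<and> 0 \<le> r) \<and> total_time w = t}"

lemma words_Nil: "unit0 P b \<in> words P S 0"
  unfolding words_def by (intro CollectI exI[of _ "[]"] exI[of _ b]) (simp add: total_time_def)

lemma words_Cons:
  assumes "\<xi> \<in> S" "0 \<le> r" "x \<in> words P S t"
  shows "tens P r t (lmul (fibre P r) b (\<xi> r)) x \<in> words P S (r + t)"
proof -
  obtain w b0 where w: "x = word P w b0" "\<forall>(b, \<xi>, r)\<in>set w. \<xi> \<in> S \<and> 0 \<le> r" "total_time w = t"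
    using assms(3) by (auto simp: words_def)
  then have "tens P r t (lmul (fibre P r) b (\<xi> r)) x = word P ((b, \<xi>, r) # w) b0"
    by simp
  moreover have "total_time ((b, \<xi>, r) # w) = r + t"
    using w by (simp add: total_time_def)
  ultimately show ?thesis
    using w assms unfolding words_def
    by (intro CollectI exI[of _ "(b, \<xi>, r) # w"] exI[of _ b0]) auto
qed

text \<open>Words arise from the elements of the zeroth fibre by multiplying with letters \<open>b \<xi>\<^sub>r\<close> from the
  left; this induction principle hides their encoding as lists.\<close>

lemma words_induct [consumes 1, case_names Nil Cons]:
  assumes "x \<in> words P S t"
    and Nil: "\<And>b. Q 0 (unit0 P b)"
    and Cons: "\<And>r b \<xi> t x. \<lbrakk>\<xi> \<in> S; 0 \<le> r; 0 \<le> t; x \<in> words P S t; Q t x\<rbrakk>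
      \<Longrightarrow> Q (r + t) (tens P r t (lmul (fibre P r) b (\<xi> r)) x)"
  shows "Q t x"
proof -
  have "total_time w = t \<Longrightarrow> 0 \<le> t \<and> Q t (word P w b0)"
    if "\<forall>(b, \<xi>, r)\<in>set w. \<xi> \<in> S \<and> 0 \<le> r" for w b0 t
    using that
  proof (induction w arbitrary: t)
    case Nil
    then show ?case using assms(2) by (simp add: total_time_def)
  next
    case (Cons a w)
    obtain b \<xi> r where a: "a = (b, \<xi>, r)" by (cases a)
    have IH: "0 \<le> total_time w" "Q (total_time w) (word P w b0)"
      using Cons by auto
    have "word P w b0 \<in> words P S (total_time w)"
      using Cons.prems by (auto simp: words_def)
    then have "Q (r + total_time w) (word P (a # w) b0)"
      using assms(3)[of \<xi> r "total_time w" "word P w b0" b] IH Cons.prems by (simp add: a)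
    moreover have "t = r + total_time w"
      using Cons.prems by (simp add: total_time_def a)
    ultimately show ?case using IH Cons.prems by (auto simp: a)
  qed
  then show ?thesis using assms(1) by (auto simp: words_def)
qed

lemma words_mono: "S \<subseteq> S' \<Longrightarrow> words P S t \<subseteq> words P S' t"
  unfolding words_def by fastforce

lemma generated_eq_closed_span: "0 \<le> t \<Longrightarrow> generated P S t = closed_span (fibre P t) (words P S t)"
  by (simp add: generated_def words_def)

locale units_of_product_system = product_system P
  for P :: "('b::unital_cstar_algebra, 'e) product_system_data" +
  fixes S :: "(real \<Rightarrow> 'e) set"
  assumes units: "S \<subseteq> units P"
begin

lemma in_carrier: "\<lbrakk>\<xi> \<in> S; 0 \<le> t\<rbrakk> \<Longrightarrow> \<xi> t \<in> carrier (fibre P t)"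
  using units unit_in_carrier by blast

lemma words_subset_carrier: "words P S t \<subseteq> carrier (fibre P t)"
proof
  fix x assume "x \<in> words P S t"
  then show "x \<in> carrier (fibre P t)"
  proof (induction rule: words_induct)
    case (Cons r b \<xi> t x)
    then show ?case
      by (simp add: tens_closed hilbert_bimodule.lmul_closed fibres in_carrier)
  qed (rule unit0_closed)
qed

lemma lmul_words:
  assumes "x \<in> words P S t"
  shows "lmul (fibre P t) c x \<in> words P S t"
  using assms
proof (induction rule: words_induct)
  case (Nil b)
  show ?case by (simp add: lmul_unit0 words_Nil)
next
  case (Cons r b \<xi> t x)
  interpret r: hilbert_bimodule "fibre P r" by (rule fibres) (rule Cons)
  have "lmul (fibre P (r + t)) c (tens P r t (lmul (fibre P r) b (\<xi> r)) x)
      = tens P r t (lmul (fibre P r) (c * b) (\<xi> r)) x"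
    using Cons subsetD[OF words_subset_carrier, of x t]
    by (simp add: lmul_tens r.lmul_mult r.lmul_closed in_carrier)
  then show ?case using Cons by (simp add: words_Cons)
qed

lemma rmul_words:
  assumes "x \<in> words P S t"
  shows "rmul (fibre P t) x c \<in> words P S t"
  using assms
proof (induction rule: words_induct)
  case (Nil b)
  show ?case by (simp add: rmul_unit0 words_Nil)
next
  case (Cons r b \<xi> t x)
  interpret r: hilbert_bimodule "fibre P r" by (rule fibres) (rule Cons)
  have "rmul (fibre P (r + t)) (tens P r t (lmul (fibre P r) b (\<xi> r)) x) c
      = tens P r t (lmul (fibre P r) b (\<xi> r)) (rmul (fibre P t) x c)"
    using Cons subsetD[OF words_subset_carrier, of x t]
    by (simp add: tens_rmul_right r.lmul_closed in_carrier)
  then show ?case using Cons by (simp add: words_Cons)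
qed

lemma tens_words:
  assumes "x \<in> words P S s" and y: "y \<in> words P S t" and t: "0 \<le> t"
  shows "tens P s t x y \<in> words P S (s + t)"
  using assms(1)
proof (induction rule: words_induct)
  case (Nil b)
  show ?case
    using y t subsetD[OF words_subset_carrier y] by (simp add: tens_zero_left lmul_words)
next
  case (Cons r b \<xi> s x)
  interpret r: hilbert_bimodule "fibre P r" by (rule fibres) (rule Cons)
  have "tens P (r + s) t (tens P r s (lmul (fibre P r) b (\<xi> r)) x) y
      = tens P r (s + t) (lmul (fibre P r) b (\<xi> r)) (tens P s t x y)"
    using Cons t subsetD[OF words_subset_carrier y] subsetD[OF words_subset_carrier, of x s]
    by (intro tens_assoc) (simp_all add: r.lmul_closed in_carrier)
  then show ?case using Cons words_Cons[of \<xi> S r "tens P s t x y" P "s + t" b]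
    by (simp add: add.assoc)
qed

lemma unit_words:
  assumes "\<xi> \<in> S" "0 \<le> t"
  shows "lmul (fibre P t) b (\<xi> t) \<in> words P S t"
proof -
  interpret t: hilbert_bimodule "fibre P t" by (rule fibres) (rule assms)
  have "tens P t 0 (lmul (fibre P t) b (\<xi> t)) (unit0 P 1) = lmul (fibre P t) b (\<xi> t)"
    using assms by (simp add: tens_zero_right t.lmul_closed in_carrier t.rmul_one)
  then show ?thesis
    using words_Cons[OF assms words_Nil[of P 1], of b] by simp
qed

text \<open>The cut at time \<open>s\<close> either falls behind the first letter, and is passed on to the remaining word by
  associativity, or it falls inside the first letter \<open>b \<xi>\<^sub>r\<close>, which is then factored as
  \<open>b \<xi>\<^sub>s \<odot> \<xi>\<^sub>r\<^sub>-\<^sub>s\<close>.\<close>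

lemma words_split:
  assumes "x \<in> words P S u" "u = s + t" "0 \<le> s" "0 \<le> t"
  shows "\<exists>y\<in>words P S s. \<exists>z\<in>words P S t. x = tens P s t y z"
  using assms
proof (induction arbitrary: s t rule: words_induct)
  case (Nil b)
  then have "s = 0" "t = 0" by auto
  moreover have "unit0 P b = tens P 0 0 (unit0 P 1) (unit0 P b)"
    by (simp add: tens_zero_left unit0_closed lmul_unit0)
  ultimately show ?case using words_Nil by blast
next
  case (Cons r b \<xi> u v)
  interpret r: hilbert_bimodule "fibre P r" by (rule fibres) (rule Cons)
  let ?a = "lmul (fibre P r) b (\<xi> r)"
  have v: "v \<in> carrier (fibre P u)" using Cons words_subset_carrier by blast
  show ?case
  proof (cases "r \<le> s")
    case True
    then have u: "u = (s - r) + t" using Cons by simp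
    obtain y z where yz: "y \<in> words P S (s - r)" "z \<in> words P S t" "v = tens P (s - r) t y z"
      using Cons.IH[OF u] True Cons.prems by auto
    have "tens P (r + (s - r)) t (tens P r (s - r) ?a y) z = tens P r ((s - r) + t) ?a (tens P (s - r) t y z)"
      using True Cons.prems Cons.hyps yz words_subset_carrier
      by (intro tens_assoc) (auto simp: r.lmul_closed in_carrier)
    then have "tens P r u ?a v = tens P s t (tens P r (s - r) ?a y) z"
      using u yz by simp
    moreover have "tens P r (s - r) ?a y \<in> words P S s"
      using words_Cons[OF Cons.hyps(1,2) yz(1), of b] by simp
    ultimately show ?thesis using yz by blast
  next
    case False
    then have rs: "0 \<le> r - s" "0 \<le> s" and t: "t = (r - s) + u" using Cons.prems by auto
    interpret s: hilbert_bimodule "fibre P s" by (rule fibres) (rule rs)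
    let ?a' = "lmul (fibre P s) b (\<xi> s)"
    have in_c: "\<xi> s \<in> carrier (fibre P s)" "\<xi> (r - s) \<in> carrier (fibre P (r - s))"
      using in_carrier[OF Cons.hyps(1)] rs by simp_all
    have "tens P s (r - s) (\<xi> s) (\<xi> (r - s)) = \<xi> r"
      using unit_tens[of \<xi> P s "r - s"] units Cons.hyps(1) rs by auto
    then have "?a = tens P s (r - s) ?a' (\<xi> (r - s))"
      using lmul_tens[of s "r - s" "\<xi> s" "\<xi> (r - s)" b] rs in_c by simp
    moreover have "tens P (s + (r - s)) u (tens P s (r - s) ?a' (\<xi> (r - s))) v
        = tens P s ((r - s) + u) ?a' (tens P (r - s) u (\<xi> (r - s)) v)"
      using rs in_c v Cons.hyps by (intro tens_assoc s.lmul_closed) simp_all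
    ultimately have "tens P r u ?a v = tens P s t ?a' (tens P (r - s) u (\<xi> (r - s)) v)"
      by (simp add: t)
    moreover have "tens P (r - s) u (\<xi> (r - s)) v \<in> words P S t"
    proof -
      have "\<xi> (r - s) \<in> words P S (r - s)"
        using unit_words[OF Cons.hyps(1) rs(1), of 1] fibres[OF rs(1)] in_c
        by (simp add: hilbert_bimodule.lmul_one)
      then show ?thesis
        unfolding t by (rule tens_words) (use Cons.hyps in auto)
    qed
    ultimately show ?thesis
      using unit_words[OF Cons.hyps(1) rs(2), of b] by blast
  qed
qed

section \<open>The subsystem generated by a set of units\<close>

lemma generated_subset_carrier: "0 \<le> t \<Longrightarrow> generated P S t \<subseteq> carrier (fibre P t)"
  by (simp add: generated_eq_closed_span hilbert_module.mclosure_subset_carrier fibre_hilbert_module)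

lemma words_subset_generated: "0 \<le> t \<Longrightarrow> words P S t \<subseteq> generated P S t"
  using hilbert_module.closed_span_base[OF fibre_hilbert_module words_subset_carrier]
  by (auto simp: generated_eq_closed_span)

lemma generated_hilbert_bimodule:
  assumes "0 \<le> t"
  shows "hilbert_bimodule (submodule_on (fibre P t) (generated P S t))"
  using hilbert_bimodule.closed_span_hilbert_bimodule[OF fibres[OF assms] words_subset_carrier]
    lmul_words rmul_words assms
  by (simp add: generated_eq_closed_span)

text \<open>Bounded bilinear maps extend to closed spans one variable at a time: first a word on the left
  and a limit on the right, then a limit on the left.\<close>

lemma tens_generated:
  assumes st: "0 \<le> s" "0 \<le> t" and x: "x \<in> generated P S s" and y: "y \<in> generated P S t"
  shows "tens P s t x y \<in> generated P S (s + t)"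
proof -
  let ?G = "closed_span (fibre P (s + t)) (words P S (s + t))"
  have st': "0 \<le> s + t" using st by simp
  note modules = fibre_hilbert_module[OF st(1)] fibre_hilbert_module[OF st(2)] fibre_hilbert_module[OF st']
  have nonneg: "0 \<le> bnorm M z" for M :: "('b, 'e) bimodule_data" and z by (simp add: bnorm_def)
  have word_left: "tens P s t a y \<in> ?G" if a: "a \<in> words P S s" for a
  proof (rule closed_span_image[OF modules(2,3) words_subset_carrier words_subset_carrier,
        where K = "2 * bnorm (fibre P s) a" and f = "tens P s t a"])
    show "y \<in> closed_span (fibre P t) (words P S t)"
      using y st by (simp add: generated_eq_closed_span)
    show "tens P s t a z \<in> ?G" if "z \<in> words P S t" for z
      by (rule hilbert_module.closed_span_base[OF modules(3) words_subset_carrier])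
        (rule tens_words[OF a that st(2)])
  qed (use st subsetD[OF words_subset_carrier a] in
      \<open>simp_all add: tens_closed tens_add_right tens_mscale_right bnorm_tens_le nonneg\<close>)
  have yc: "y \<in> carrier (fibre P t)" using y generated_subset_carrier[OF st(2)] by blast
  have "tens P s t x y \<in> ?G"
  proof (rule closed_span_image[OF modules(1,3) words_subset_carrier words_subset_carrier,
        where K = "2 * bnorm (fibre P t) y" and f = "\<lambda>x. tens P s t x y"])
    show "x \<in> closed_span (fibre P s) (words P S s)"
      using x st by (simp add: generated_eq_closed_span)
    show "bnorm (fibre P (s + t)) (tens P s t z y) \<le> 2 * bnorm (fibre P t) y * bnorm (fibre P s) z"
      if "z \<in> carrier (fibre P s)" for z
      using bnorm_tens_le[OF st that yc] by (simp add: mult_ac)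
  qed (use st yc in \<open>simp_all add: tens_closed tens_add_left tens_mscale_left nonneg word_left\<close>)
  then show ?thesis using st' by (simp add: generated_eq_closed_span)
qed

text \<open>Density of the elementary tensors rests on the splitting of words: the words of length \<open>s + t\<close>
  are among the elementary tensors of words.\<close>

lemma generated_interior_tensor:
  assumes st: "0 \<le> s" "0 \<le> t"
  shows "interior_tensor (submodule_on (fibre P s) (generated P S s))
    (submodule_on (fibre P t) (generated P S t))
    (submodule_on (fibre P (s + t)) (generated P S (s + t))) (tens P s t)"
proof -
  let ?G = "generated P S"
  let ?T = "{tens P s t x y |x y. x \<in> ?G s \<and> y \<in> ?G t}"
  have st': "0 \<le> s + t" using st by simp
  interpret st: hilbert_bimodule "fibre P (s + t)" by (rule fibres) (rule st')
  interpret G: hilbert_bimodule "submodule_on (fibre P (s + t)) (?G (s + t))"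
    by (rule generated_hilbert_bimodule) (rule st')
  have Gs: "x \<in> carrier (fibre P s)" if "x \<in> ?G s" for x
    using that generated_subset_carrier[OF st(1)] by blast
  have Gt: "x \<in> carrier (fibre P t)" if "x \<in> ?G t" for x
    using that generated_subset_carrier[OF st(2)] by blast
  have T: "?T \<subseteq> ?G (s + t)" using tens_generated[OF st] by blast
  have "mspan (fibre P (s + t)) ?T \<subseteq> ?G (s + t)"
    using G.mspan_subset_carrier T by (simp add: mspan_submodule_on)
  then have "mclosure (submodule_on (fibre P (s + t)) (?G (s + t))) (mspan (fibre P (s + t)) ?T)
      = closed_span (fibre P (s + t)) ?T \<inter> ?G (s + t)"
    by (intro mclosure_submodule_on st.hilbert_module_axioms G.hilbert_module_axioms
        generated_subset_carrier[OF st'])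
  moreover have "?G (s + t) \<subseteq> closed_span (fibre P (s + t)) ?T"
  proof -
    have "words P S (s + t) \<subseteq> ?T"
    proof
      fix x assume "x \<in> words P S (s + t)"
      then obtain y z where "y \<in> words P S s" "z \<in> words P S t" "x = tens P s t y z"
        using words_split st by blast
      then show "x \<in> ?T" using words_subset_generated st by blast
    qed
    then show ?thesis
      unfolding generated_eq_closed_span[OF st'] by (intro st.mclosure_mono mspan_mono)
  qed
  ultimately show ?thesis
    unfolding interior_tensor_def
    using generated_hilbert_bimodule st st' tens_generated[OF st]
    by (simp add: mspan_submodule_on ip_tens lmul_tens Gs Gt Int_absorb1)
qed

lemma subsystem_generated: "subsystem P (generated P S)"
  unfolding subsystem_def
  using generated_subset_carrier generated_hilbert_bimodule generated_interior_tensor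
  by (simp add: generated_def)

end

section \<open>Subsystems as product systems and completely spatial subsystems\<close>

lemma restrict_system_simps:
  "fibre (restrict_system P F) t = submodule_on (fibre P t) (F t)"
  "tens (restrict_system P F) = tens P"
  "unit0 (restrict_system P F) = unit0 P"
  by (simp_all add: restrict_system_def)

lemma word_restrict_system: "word (restrict_system P F) w b = word P w b"
  by (induction w) (auto simp: restrict_system_simps)

lemma words_restrict_system: "words (restrict_system P F) S t = words P S t"
  by (simp add: words_def word_restrict_system)

lemma continuous_units_restrict_system:
  "continuous_units (restrict_system P F) S \<longleftrightarrow> continuous_units P S"
proof -
  have "unit_semigroup (restrict_system P F) \<xi> \<xi>' = unit_semigroup P \<xi> \<xi>'" for \<xi> \<xi>'
    by (simp add: fun_eq_iff unit_semigroup_def restrict_system_simps)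
  then show ?thesis by (simp add: continuous_units_def)
qed

lemma units_restrict_system:
  assumes "\<And>t. 0 \<le> t \<Longrightarrow> F t \<subseteq> carrier (fibre P t)"
  shows "units (restrict_system P F) = {\<xi> \<in> units P. \<forall>t\<ge>0. \<xi> t \<in> F t}"
  using assms by (auto simp: units_def restrict_system_simps PiE_iff)

context product_system
begin

lemma product_system_restrict_system:
  assumes sub: "subsystem P F" and zero: "F 0 = carrier (fibre P 0)"
  shows "product_system (restrict_system P F)"
proof -
  have F: "x \<in> carrier (fibre P t)" if "0 \<le> t" "x \<in> F t" for x t
    using that sub by (auto simp: subsystem_def)
  show ?thesis
  proof (rule product_system.intro)
    show "two_sided_unitary algebra_bimodule (fibre (restrict_system P F) 0) (unit0 (restrict_system P F))"
      using fibre_zero by (simp add: restrict_system_simps two_sided_unitary_def zero)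
    fix r s t :: real and x y z
    assume "0 \<le> r" "0 \<le> s" "0 \<le> t" "x \<in> carrier (fibre (restrict_system P F) r)"
      "y \<in> carrier (fibre (restrict_system P F) s)" "z \<in> carrier (fibre (restrict_system P F) t)"
    then show "tens (restrict_system P F) (r + s) t (tens (restrict_system P F) r s x y) z
        = tens (restrict_system P F) r (s + t) x (tens (restrict_system P F) s t y z)"
      by (simp add: restrict_system_simps F tens_assoc)
  qed (use sub in \<open>simp_all add: restrict_system_simps subsystem_def F tens_zero_left tens_zero_right\<close>)
qed

text \<open>The closure in a subsystem is the trace of the ambient closure, so a subsystem generated by
  its own units lies in what these units generate in the ambient system.\<close>

lemma generated_restrict_system:
  assumes sub: "subsystem P F" and "product_system (restrict_system P F)"
    and S: "S \<subseteq> units (restrict_system P F)" and t: "0 \<le> t"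
  shows "generated (restrict_system P F) S t = generated P S t \<inter> F t"
proof -
  interpret F: units_of_product_system "restrict_system P F" S
    using assms by (simp add: units_of_product_system_def units_of_product_system_axioms_def)
  have "mspan (fibre P t) (words P S t) \<subseteq> F t"
    using hilbert_module.mspan_subset_carrier[OF F.fibre_hilbert_module[OF t] F.words_subset_carrier]
    by (simp add: restrict_system_simps words_restrict_system mspan_submodule_on)
  then have "mclosure (submodule_on (fibre P t) (F t)) (mspan (fibre P t) (words P S t))
      = closed_span (fibre P t) (words P S t) \<inter> F t"
    using sub t F.fibre_hilbert_module[OF t] fibre_hilbert_module[OF t]
    by (intro mclosure_submodule_on) (simp_all add: subsystem_def restrict_system_simps)
  then show ?thesis
    using t by (simp add: generated_eq_closed_span restrict_system_simps words_restrict_system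
        mspan_submodule_on)
qed

lemma generated_mono: "\<lbrakk>S \<subseteq> S'; 0 \<le> t\<rbrakk> \<Longrightarrow> generated P S t \<subseteq> generated P S' t"
  by (simp add: generated_eq_closed_span hilbert_module.mclosure_mono[OF fibre_hilbert_module]
      mspan_mono words_mono)

text \<open>The zeroth fibre of a generated subsystem is the whole algebra, as it contains the words
  without letters; this is what the identification with the algebra requires.\<close>

lemma completely_spatial_subsystem_generated:
  assumes spatial: "spatial_product_system P \<omega>"
    and S: "S \<subseteq> units P" "\<omega> \<in> S" "continuous_units P S"
  shows "completely_spatial_subsystem P \<omega> (generated P S)"
proof -
  interpret units_of_product_system P S by unfold_locales (rule S)
  let ?R = "restrict_system P (generated P S)"
  have in_generated: "\<xi> t \<in> generated P S t" if "\<xi> \<in> S" "0 \<le> t" for \<xi> t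
  proof -
    have "lmul (fibre P t) 1 (\<xi> t) = \<xi> t"
      using that by (simp add: hilbert_bimodule.lmul_one fibres in_carrier)
    then show ?thesis
      using unit_words[OF that, of 1] words_subset_generated[OF that(2)] by auto
  qed
  have zero: "generated P S 0 = carrier (fibre P 0)"
  proof
    have "carrier (fibre P 0) = range (unit0 P)"
      using fibre_zero by (simp add: two_sided_unitary_def algebra_bimodule_def bij_betw_def)
    then show "carrier (fibre P 0) \<subseteq> generated P S 0"
      using words_Nil[of P _ S] words_subset_generated[of 0] by auto
  qed (simp add: generated_subset_carrier)
  have R: "product_system ?R"
    by (rule product_system_restrict_system) (simp_all add: subsystem_generated zero)
  have SR: "S \<subseteq> units ?R"
    using S in_generated by (auto simp: units_restrict_system generated_subset_carrier)
  have "spatial_product_system ?R \<omega>"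
    using spatial R S SR
    by (auto simp: spatial_product_system_def unital_unit_def central_unit_def restrict_system_simps)
  moreover have "generated ?R S t = carrier (fibre ?R t)" if "0 \<le> t" for t
    using that by (simp add: generated_restrict_system subsystem_generated R SR restrict_system_simps)
  ultimately have "completely_spatial ?R \<omega>"
    unfolding completely_spatial_def using SR S
    by (auto simp: continuous_units_restrict_system)
  then show ?thesis
    using in_generated S by (simp add: completely_spatial_subsystem_def spatial_subsystem_def subsystem_generated)
qed

text \<open>A continuous set of units of a subsystem containing the reference unit is such a set in the
  ambient system as well, since the semigroups depend only on the inner products and left
  actions, which the subsystem inherits.\<close>

lemma completely_spatial_subsystem_subset_generated:
  assumes F: "completely_spatial_subsystem P \<omega> F" and t: "0 \<le> t"
  shows "F t \<subseteq> generated P (units_continuous_with P \<omega>) t"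
proof -
  let ?R = "restrict_system P F"
  have sub: "subsystem P F" and R: "product_system ?R"
    using F by (simp_all add: completely_spatial_subsystem_def spatial_subsystem_def
        completely_spatial_def spatial_product_system_def)
  obtain S where S: "S \<subseteq> units ?R" "\<omega> \<in> S" "continuous_units ?R S"
    and gen: "\<And>t. 0 \<le> t \<Longrightarrow> generated ?R S t = carrier (fibre ?R t)"
    using F by (auto simp: completely_spatial_subsystem_def completely_spatial_def)
  have "S \<subseteq> units P"
    using S(1) sub by (auto simp: units_restrict_system subsystem_def)
  then have "S \<subseteq> units_continuous_with P \<omega>"
    using S by (intro continuous_set_subset) (simp_all add: continuous_units_restrict_system)
  moreover have "F t \<subseteq> generated P S t"
    using gen[OF t] generated_restrict_system[OF sub R S(1) t]
    by (simp add: restrict_system_simps) blast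
  ultimately show ?thesis using generated_mono[OF _ t] by blast
qed

end

theorem corollary3p4:
  fixes P :: "('b::unital_cstar_algebra, 'e) product_system_data"
    and \<omega> :: "real \<Rightarrow> 'e"
  assumes "spatial_product_system P \<omega>"
  shows "units_continuous_with P \<omega> \<subseteq> units P \<and>
    \<omega> \<in> units_continuous_with P \<omega> \<and>
    continuous_units P (units_continuous_with P \<omega>) \<and>
    (\<forall>S. S \<subseteq> units P \<and> \<omega> \<in> S \<and> continuous_units P S \<longrightarrow> S \<subseteq> units_continuous_with P \<omega>) \<and>
    completely_spatial_subsystem P \<omega> (generated P (units_continuous_with P \<omega>)) \<and>
    (\<forall>F. completely_spatial_subsystem P \<omega> F \<longrightarrow>
      (\<forall>t\<ge>0. F t \<subseteq> generated P (units_continuous_with P \<omega>) t)) \<and>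
    (\<forall>F. maximal_completely_spatial_subsystem P \<omega> F \<longleftrightarrow>
      F = generated P (units_continuous_with P \<omega>))"
proof -
  interpret product_system P using assms by (simp add: spatial_product_system_def)
  let ?U = "units_continuous_with P \<omega>"
  let ?G = "generated P ?U"
  have U: "?U \<subseteq> units P" by (auto simp: units_continuous_with_def)
  have \<omega>: "\<omega> \<in> ?U" by (rule reference_unit_continuous) (rule assms)
  have cont: "continuous_units P ?U"
    by (rule continuous_units_continuous_with_reference) (rule assms)
  have G: "completely_spatial_subsystem P \<omega> ?G"
    using assms U \<omega> cont by (rule completely_spatial_subsystem_generated)
  have largest: "F t \<subseteq> ?G t" if "completely_spatial_subsystem P \<omega> F" "0 \<le> t" for F t
    using that by (rule completely_spatial_subsystem_subset_generated)
  have antisym: "F = ?G" if F: "completely_spatial_subsystem P \<omega> F" and "\<forall>t\<ge>0. ?G t \<subseteq> F t" for F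
  proof (rule extensionalityI[of _ "{0..}"])
    show "F \<in> extensional {0..}"
      using F by (simp add: completely_spatial_subsystem_def spatial_subsystem_def subsystem_def)
    show "?G \<in> extensional {0..}" by (simp add: generated_def)
    show "F t = ?G t" if "t \<in> {0..}" for t
      using that largest[OF F] \<open>\<forall>t\<ge>0. ?G t \<subseteq> F t\<close> by auto
  qed
  have "maximal_completely_spatial_subsystem P \<omega> F \<longleftrightarrow> F = ?G" for F
    using G largest antisym unfolding maximal_completely_spatial_subsystem_def by metis
  then show ?thesis
    using U \<omega> cont G largest by (intro conjI allI impI) (auto dest: continuous_set_subset)
qed

end
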